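(* Let $r\ge 1$ be an integer. (1) Let $x_0,x_1,\dots,x_{2r}$ be complex numbers such that $x_{2i}x_{2i+1}=1$ for $i=0,1,\dots,r-1$ (so in particular $x_0=1/x_1$ is an auxiliary parameter). Then $$\chi_{2r}(x_1,\dots,x_{2r};q)=\frac{(-q^{1/2}x_{2r};q)_{\infty}}{(q;q)_{\infty}^{r-1}}\sum_{n_1,\dots,n_{r+1}\geq0}\Bigg(\frac{q^{\frac12 n_1^2+\frac12(n_1+n_2)^2+\frac14\sum_{i=2}^r(n_i-n_{i+1})^2}}{(q;q)_{n_1}\cdots (q;q)_{n_{r+1}}}\; x_0^{-n_1}\prod_{j=1}^r\Big(\frac{x_{2j}}{x_{2j-2}}\Big)^{n_{j+1}} \prod_{k=2}^r\Big(\sum_{\ell_k\in\mathbb{Z}}q^{(\ell_k-\frac{n_k-n_{k+1}}{2})^2}x_{2k-2}^{-\ell_k}\Big)\Bigg).$$ (2) Let $x_1,\dots,x_{2r+1}$ be complex numbers such that $x_{2i-1}x_{2i}=1$ for $i=1,\dots,r$. Then $$\chi_{2r+1}(x_1,\dots,x_{2r+1};q)=\frac{(-q^{1/2}x_{2r+1};q)_{\infty}}{(q;q)_{\infty}^{r}}\sum_{n_{1},\dots,n_{r}\geq 0}\Bigg(\frac{q^{\frac14\sum_{i=1}^{r}(n_i-n_{i-1})^2}}{(q;q)_{n_{1}}\cdots (q;q)_{n_{r}}}\prod_{j=1}^{r}\Big(\frac{x_{2j+1}}{x_{2j-1}}\Big)^{n_j}\prod_{k=1}^{r}\Big(\sum_{\ell_{k}\in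 \mathbb{Z}}q^{(\ell_{k}-\frac{n_{k-1}-n_{k}}{2})^2}x_{2k-1}^{-\ell_k}\Big)\Bigg),$$ where $n_0=0$.
   Context: Throughout $0<|q|<1$, $q^{1/4}$ is a fixed fourth root of $q$, and all fractional powers of $q$ are powers of it. Empty sums are $0$, empty products are $1$, and $0^0=1$. $q$-Pochhammer symbols: $(a;q)_n=\prod_{k=0}^{n-1}(1-aq^k)$ and $(a;q)_\infty=\prod_{k=0}^{\infty}(1-aq^k)$. The tadpole Cartan matrix $T_r=(a_{ij})_{r\times r}$ is defined by $a_{rr}=1$, $a_{ii}=2$ for $i<r$, $a_{ij}=-1$ for $|i-j|=1$, and $a_{ij}=0$ otherwise (with $T_1=(1)$). The generalized tadpole Nahm sum is $$\chi_r(x_1,\dots,x_r;q)=\sum_{n=(n_1,\dots,n_r)^{\mathrm T}\in(\mathbb{Z}_{\ge0})^r}\frac{q^{\frac12 n^{\mathrm T}T_r n}x_1^{n_1}\cdots x_r^{n_r}}{(q;q)_{n_1}\cdots (q;q)_{n_r}}.$$ *)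

theory Defs
  imports "HOL-Analysis.Analysis"
begin

text \<open>
  Throughout, \<open>h\<close> stands for the fixed fourth root \<open>q\<^sup>1\<^sup>/\<^sup>4\<close> of \<open>q\<close>. The power \<open>q\<^sup>e\<close> with
  \<open>4 * e\<close> an integer is \<open>h\<close> raised to \<open>4 * e\<close>. All exponents used are quarter-integers, so
  the floor below never rounds.
\<close>

definition qpow :: "complex \<Rightarrow> real \<Rightarrow> complex" where
  "qpow h e = h powi \<lfloor>4 * e\<rfloor>"

lemma qpow_quarter: "qpow h (of_int k / 4) = h powi k"
  by (simp add: qpow_def)

lemma qpow_nat: "h ^ 4 = q \<Longrightarrow> qpow h (of_nat n) = q ^ n"
proof -
  assume "h ^ 4 = q"
  have "\<lfloor>4 * real n\<rfloor> = int (4 * n)"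
    by linarith
  then have "qpow h (of_nat n) = h ^ (4 * n)"
    by (simp add: qpow_def power_int_def nat_mult_distrib)
  then show ?thesis
    using \<open>h ^ 4 = q\<close> by (simp add: power_mult)
qed

definition qpoch :: "complex \<Rightarrow> complex \<Rightarrow> nat \<Rightarrow> complex" where
  "qpoch a q n = (\<Prod>k<n. 1 - a * q ^ k)"

definition qpoch_inf :: "complex \<Rightarrow> complex \<Rightarrow> complex" where
  "qpoch_inf a q = prodinf (\<lambda>k. 1 - a * q ^ k)"

text \<open>
  Tuples \<open>(n\<^sub>1, \<dots>, n\<^sub>r)\<close> of nonnegative integers, as functions vanishing outside \<open>{1..r}\<close>.
  In particular \<open>n 0 = 0\<close>.
\<close>

definition tuples :: "nat \<Rightarrow> (nat \<Rightarrow> nat) set" where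
  "tuples r = {n. \<forall>i. i \<notin> {1..r} \<longrightarrow> n i = 0}"

definition tadpole :: "nat \<Rightarrow> nat \<Rightarrow> nat \<Rightarrow> int" where
  "tadpole r i j =
     (if i = j then (if i = r then 1 else 2)
      else if \<bar>int i - int j\<bar> = 1 then -1 else 0)"

definition tadpole_form :: "nat \<Rightarrow> (nat \<Rightarrow> nat) \<Rightarrow> int" where
  "tadpole_form r n = (\<Sum>i=1..r. \<Sum>j=1..r. int (n i) * tadpole r i j * int (n j))"

definition nahm_term ::
  "complex \<Rightarrow> complex \<Rightarrow> nat \<Rightarrow> (nat \<Rightarrow> complex) \<Rightarrow> (nat \<Rightarrow> nat) \<Rightarrow> complex" where
  "nahm_term q h r x n =
     qpow h (1/2 * of_int (tadpole_form r n)) * (\<Prod>i=1..r. x i ^ n i) / (\<Prod>i=1..r. qpoch q q (n i))"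

definition nahm_sum :: "complex \<Rightarrow> complex \<Rightarrow> nat \<Rightarrow> (nat \<Rightarrow> complex) \<Rightarrow> complex" where
  "nahm_sum q h r x = (\<Sum>\<^sub>\<infinity>n\<in>tuples r. nahm_term q h r x n)"

end

theory Submission
  imports Defs
begin

text \<open>
  Write \<open>(q)\<^sub>n\<close> for \<open>(q;q)\<^sub>n\<close>. The tadpole form is a sum of squares of differences of neighbours,
  so a Nahm sum is a chain in which \<open>n\<^sub>j\<close> interacts only with \<open>n\<^sub>j\<^sub>+\<^sub>1\<close>, through \<open>q\<close> to the power
  \<open>- n\<^sub>j n\<^sub>j\<^sub>+\<^sub>1\<close>. The chain is taken apart by a single identity, the Durfee rectangle expansion
  (lemma \<open>inverse_poch_product\<close>)

  \<open>1 / ((q)\<^sub>n (q)\<^sub>c) = (\<Sum>k. q\<^bsup>(n-k)(c-k)\<^esup> / ((q)\<^sub>k (q)\<^sub>n\<^sub>-\<^sub>k (q)\<^sub>c\<^sub>-\<^sub>k))\<close>.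

  In a chain of odd length \<open>2r + 1\<close> it is applied to each pair \<open>(n\<^sub>2\<^sub>i, n\<^sub>2\<^sub>i\<^sub>+\<^sub>1)\<close>, with summation
  variable \<open>k\<^sub>i\<close>. Substitute \<open>n\<^sub>2\<^sub>i = m\<^sub>2\<^sub>i + k\<^sub>i\<close> and \<open>n\<^sub>2\<^sub>i\<^sub>+\<^sub>1 = m\<^sub>2\<^sub>i\<^sub>+\<^sub>1 + k\<^sub>i\<close>. The new factor
  \<open>q\<close> to the power \<open>m\<^sub>2\<^sub>i m\<^sub>2\<^sub>i\<^sub>+\<^sub>1\<close> is exactly what removes the interaction of \<open>m\<^sub>2\<^sub>i\<close> with
  \<open>m\<^sub>2\<^sub>i\<^sub>+\<^sub>1\<close> (lemma \<open>chain_form_decoupled\<close>). For fixed \<open>k\<close> the sum over \<open>m\<close> is therefore a product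
  of \<open>r\<close> double sums, one for each pair \<open>(m\<^sub>2\<^sub>i\<^sub>-\<^sub>1, m\<^sub>2\<^sub>i)\<close>, and of a simple sum over \<open>m\<^sub>2\<^sub>r\<^sub>+\<^sub>1\<close>, which
  by Euler is the factor \<open>(-q\<^sup>1\<^sup>/\<^sup>2 x\<^sub>2\<^sub>r\<^sub>+\<^sub>1; q)\<^sub>\<infinity>\<close>. This holds for all values of the \<open>x\<^sub>j\<close>
  (theorem \<open>nahm_sum_odd_chain\<close>).

  When \<open>x\<^sub>2\<^sub>i\<^sub>-\<^sub>1 x\<^sub>2\<^sub>i = 1\<close>, a double sum sees its variables \<open>M\<close> and \<open>N\<close> only through \<open>M - N\<close>, apart from
  a factor \<open>q\<^bsup>M N\<^esup> / ((q)\<^sub>M (q)\<^sub>N)\<close>. For a fixed difference these factors add up to \<open>1 / (q)\<^sub>\<infinity>\<close>, which is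
  the Durfee expansion again, in the limit (lemma \<open>durfee_rectangle\<close>). What remains is a theta series
  in \<open>M - N\<close> (lemma \<open>theta_has_sum\<close>). This gives the formula for \<open>2r + 1\<close> variables.

  A chain with \<open>2r\<close> variables is a chain with \<open>2r + 1\<close> variables whose first parameter is \<open>0\<close>, because
  this forces the first summation index to vanish. The first double sum then shrinks to the simple sum
  over \<open>n\<^sub>1\<close> in the formula for \<open>2r\<close> variables, and the other \<open>r - 1\<close> double sums are theta series as before.

  All rearrangements take place inside one absolutely convergent family: after the substitution the
  exponent is positive definite in \<open>(m, k)\<close> jointly, so its terms are dominated by products of
  Gaussians (lemma \<open>decoupled_summable\<close>).
\<close>

section \<open>The q-shifted factorials\<close>

lemma qpoch_0 [simp]: "qpoch a q 0 = 1"
  by (simp add: qpoch_def)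

lemma qpoch_Suc: "qpoch a q (Suc n) = qpoch a q n * (1 - a * q ^ n)"
  by (simp add: qpoch_def)

lemma gaussian_summable:
  fixes \<sigma> A :: real
  assumes "0 < \<sigma>" and "\<sigma> < 1"
  shows "summable (\<lambda>n. A ^ n * \<sigma> ^ n\<^sup>2)"
proof -
  have "(\<lambda>n. \<bar>A\<bar> * \<sigma> ^ n) \<longlonglongrightarrow> \<bar>A\<bar> * 0"
    using assms by (intro tendsto_intros LIMSEQ_power_zero) auto
  then have "eventually (\<lambda>n. \<bar>A\<bar> * \<sigma> ^ n < 1/2) sequentially"
    by (intro order_tendstoD) auto
  then have "eventually (\<lambda>n. norm (A ^ n * \<sigma> ^ n\<^sup>2) \<le> (1/2) ^ n) sequentially"
  proof eventually_elim
    case (elim n)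
    have "norm (A ^ n * \<sigma> ^ n\<^sup>2) = (\<bar>A\<bar> * \<sigma> ^ n) ^ n"
      using assms by (simp add: abs_mult power_abs power_mult_distrib power_mult[symmetric] power2_eq_square)
    also have "\<dots> \<le> (1/2) ^ n"
      using elim assms by (intro power_mono) auto
    finally show ?case .
  qed
  then show ?thesis
    by (rule summable_comparison_test_ev) (auto intro: summable_geometric)
qed

locale quarter_nome =
  fixes q h :: complex
  assumes norm_q_pos: "0 < norm q" and norm_q_less_1: "norm q < 1" and h_power: "h ^ 4 = q"
begin

abbreviation poch :: "nat \<Rightarrow> complex" where
  "poch n \<equiv> qpoch q q n"

lemma q_nonzero [simp]: "q \<noteq> 0"
  using norm_q_pos by auto

lemma h_nonzero [simp]: "h \<noteq> 0"
  using h_power q_nonzero by (metis power_zero_numeral)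

lemma norm_h_less_1: "norm h < 1"
proof (rule ccontr)
  assume "\<not> norm h < 1"
  then have "1 \<le> norm h ^ 4"
    by (simp add: one_le_power)
  then show False
    using norm_q_less_1 by (metis h_power norm_power not_le)
qed

lemma one_minus_q_power_nonzero: "1 - q * q ^ n \<noteq> 0"
proof
  assume "1 - q * q ^ n = 0"
  then have "norm (q ^ Suc n) = 1"
    by (metis eq_iff_diff_eq_0 norm_one power_Suc)
  then show False
    using norm_q_less_1 norm_q_pos power_Suc_less_one[of "norm q" n] by (simp add: norm_power norm_mult)
qed

lemma q_power_Suc_neq_1 [simp]: "q * q ^ n \<noteq> 1"
  using one_minus_q_power_nonzero[of n] by simp

lemma poch_nonzero [simp]: "poch n \<noteq> 0"
  by (simp add: qpoch_def eq_commute[of 1])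

lemma qpoch_inf_convergent: "convergent_prod (\<lambda>k. 1 - a * q ^ k)"
proof -
  have "summable (\<lambda>k. norm a * norm q ^ k)"
    using norm_q_less_1 by (intro summable_mult summable_geometric) auto
  then have "summable (\<lambda>k. norm ((1 - a * q ^ k) - 1))"
    by (simp add: norm_mult norm_power)
  then show ?thesis
    by (intro abs_convergent_prod_imp_convergent_prod summable_imp_abs_convergent_prod)
qed

lemma qpoch_tendsto: "(\<lambda>n. qpoch a q n) \<longlonglongrightarrow> qpoch_inf a q"
proof -
  have "(\<lambda>n. qpoch a q (Suc n)) \<longlonglongrightarrow> qpoch_inf a q"
    using convergent_prod_LIMSEQ[OF qpoch_inf_convergent, of a]
    by (simp add: qpoch_def qpoch_inf_def lessThan_Suc_atMost)
  then show ?thesis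
    by (rule LIMSEQ_imp_Suc)
qed

lemma poch_inf_nonzero [simp]: "qpoch_inf q q \<noteq> 0"
  unfolding qpoch_inf_def
  by (rule prodinf_nonzero[OF qpoch_inf_convergent]) (rule one_minus_q_power_nonzero)

lemma poch_bounds:
  obtains K where "K \<ge> 1" "\<And>n. norm (poch n) \<le> K" "\<And>n. norm (1 / poch n) \<le> K"
proof -
  have "Bseq (\<lambda>n. poch n)"
    using qpoch_tendsto convergent_imp_Bseq convergentI by blast
  then obtain K1 where K1: "\<And>n. norm (poch n) \<le> K1"
    unfolding Bseq_def by auto
  have "(\<lambda>n. 1 / poch n) \<longlonglongrightarrow> 1 / qpoch_inf q q"
    by (intro tendsto_intros qpoch_tendsto) simp
  then have "Bseq (\<lambda>n. 1 / poch n)"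
    using convergent_imp_Bseq convergentI by blast
  then obtain K2 where K2: "\<And>n. norm (1 / poch n) \<le> K2"
    unfolding Bseq_def by auto
  show thesis
    by (rule that[of "max 1 (max K1 K2)"]) (use K1 K2 in \<open>auto simp: le_max_iff_disj\<close>)
qed

section \<open>Durfee rectangles and Euler's expansion\<close>

text \<open>
  Write \<open>S N d\<close> for the left-hand side multiplied by \<open>(q)\<^sub>N\<close>. The Pascal rule for the \<open>q\<close>-binomial
  coefficient \<open>(q)\<^sub>N / ((q)\<^sub>n (q)\<^sub>N\<^sub>-\<^sub>n)\<close> splits \<open>S (N + 1) d\<close> into two sums, and
  \<open>1 / (q)\<^sub>n\<^sub>+\<^sub>d = (1 - q\<^bsup>n+d+1\<^esup>) / (q)\<^sub>n\<^sub>+\<^sub>d\<^sub>+\<^sub>1\<close> makes all but one part of them cancel. This leaves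
  \<open>S (N + 1) d = S N (d + 1)\<close>, so that \<open>S N d = S 0 (N + d) = 1 / (q)\<^sub>N\<^sub>+\<^sub>d\<close>.
\<close>

lemma durfee_rectangle_finite:
  "(\<Sum>n\<le>N. q ^ (n * (n + d)) / (poch n * poch (N - n) * poch (n + d)))
     = 1 / (poch N * poch (N + d))"
proof (induction N arbitrary: d)
  case 0
  then show ?case by simp
next
  case (Suc N)
  let ?t = "\<lambda>n. q ^ (n * (n + Suc d)) / (poch n * poch (N - n) * poch (n + Suc d))"
  let ?A = "\<lambda>n. q ^ (n * (n + d)) * (1 - q ^ n) / (poch n * poch (Suc N - n) * poch (n + d))"
  let ?B = "\<lambda>n. q ^ (n * (n + d)) * q ^ n * (1 - q ^ (Suc N - n))
                  / (poch n * poch (Suc N - n) * poch (n + d))"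
  have split: "(1 - q ^ Suc N) * (q ^ (n * (n + d)) / (poch n * poch (Suc N - n) * poch (n + d)))
      = ?A n + ?B n" if "n \<le> Suc N" for n
  proof -
    have "q ^ n * q ^ (Suc N - n) = q ^ Suc N"
      using that by (metis le_add_diff_inverse power_add)
    then have *: "1 - q ^ Suc N = (1 - q ^ n) + q ^ n * (1 - q ^ (Suc N - n))"
      by (simp add: algebra_simps)
    show ?thesis
      unfolding * times_divide_eq_right add_divide_distrib[symmetric]
      by (rule arg_cong2[of _ _ _ _ "(/)"]) (simp_all add: algebra_simps)
  qed
  \<comment> \<open>The summand for \<open>n = 0\<close> vanishes, and \<open>n\<close> is shifted by one.\<close>
  have A: "(\<Sum>n\<le>Suc N. ?A n)
      = (\<Sum>n\<le>N. q ^ (Suc n * (Suc n + d)) / (poch n * poch (N - n) * poch (n + Suc d)))"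
  proof -
    have "(\<Sum>n\<le>Suc N. ?A n) = (\<Sum>n\<le>N. ?A (Suc n))"
      by (subst sum.atMost_Suc_shift) simp
    also have "\<dots> = (\<Sum>n\<le>N. q ^ (Suc n * (Suc n + d)) / (poch n * poch (N - n) * poch (n + Suc d)))"
      by (intro sum.cong refl) (simp add: qpoch_Suc)
    finally show ?thesis .
  qed
  have B: "(\<Sum>n\<le>Suc N. ?B n)
      = (\<Sum>n\<le>N. q ^ (n * (n + Suc d)) * (1 - q ^ (n + Suc d)) / (poch n * poch (N - n) * poch (n + Suc d)))"
  proof -
    have "(\<Sum>n\<le>Suc N. ?B n) = (\<Sum>n\<le>N. ?B n)"
      by simp
    also have "\<dots> = (\<Sum>n\<le>N. q ^ (n * (n + Suc d)) * (1 - q ^ (n + Suc d)) / (poch n * poch (N - n) * poch (n + Suc d)))"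
    proof (intro sum.cong refl)
      fix n assume "n \<in> {..N}"
      then have *: "Suc N - n = Suc (N - n)"
        by auto
      have "1 - q * q ^ (N - n) \<noteq> 0" "1 - q * q ^ (n + d) \<noteq> 0"
        by (rule one_minus_q_power_nonzero)+
      then show "?B n = q ^ (n * (n + Suc d)) * (1 - q ^ (n + Suc d)) / (poch n * poch (N - n) * poch (n + Suc d))"
        unfolding * by (simp add: qpoch_Suc power_add[symmetric]) (simp add: power_add mult_ac)
    qed
    finally show ?thesis .
  qed
  have cancel: "s = t / (1 - q ^ Suc N)" if "(1 - q ^ Suc N) * s = t" for s t
    using that by auto
  have "(1 - q ^ Suc N) * (\<Sum>n\<le>Suc N. q ^ (n * (n + d)) / (poch n * poch (Suc N - n) * poch (n + d)))
      = (\<Sum>n\<le>Suc N. ?A n) + (\<Sum>n\<le>Suc N. ?B n)"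
    unfolding sum_distrib_left sum.distrib[symmetric]
    by (intro sum.cong refl split) simp
  also have "\<dots> = (\<Sum>n\<le>N. ?t n)"
    unfolding A B sum.distrib[symmetric]
    by (intro sum.cong refl) (simp add: power_add add_divide_distrib[symmetric] algebra_simps)
  also have "\<dots> = 1 / (poch N * poch (N + Suc d))"
    by (rule Suc.IH)
  finally have "(1 - q ^ Suc N) * (\<Sum>n\<le>Suc N. q ^ (n * (n + d)) / (poch n * poch (Suc N - n) * poch (n + d)))
      = 1 / (poch N * poch (N + Suc d))" .
  then have "(\<Sum>n\<le>Suc N. q ^ (n * (n + d)) / (poch n * poch (Suc N - n) * poch (n + d)))
      = 1 / (poch N * poch (N + Suc d)) / (1 - q ^ Suc N)"
    by (rule cancel)
  then show ?case
    by (simp add: qpoch_Suc[of q q N] mult_ac)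
qed

text \<open>
  The finite Durfee expansion read backwards, with \<open>k = N - n\<close>. In this form it is symmetric in \<open>n\<close> and \<open>c\<close>,
  and its exponent \<open>(n - k) (c - k)\<close> is a product, which is what decouples two neighbours in a chain.
\<close>

lemma inverse_poch_product:
  "1 / (poch n * poch c) =
     (\<Sum>k\<le>min n c. q ^ ((n - k) * (c - k)) / (poch k * poch (n - k) * poch (c - k)))"
proof -
  have *: "1 / (poch n * poch c) =
     (\<Sum>k\<le>n. q ^ ((n - k) * (c - k)) / (poch k * poch (n - k) * poch (c - k)))"
    if "n \<le> c" for n c
  proof -
    from that obtain d where c: "c = n + d"
      using le_Suc_ex by blast
    have "1 / (poch n * poch c) = (\<Sum>k\<le>n. q ^ (k * (k + d)) / (poch k * poch (n - k) * poch (k + d)))"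
      using durfee_rectangle_finite[where N = n and d = d] by (simp add: c)
    also have "\<dots> = (\<Sum>k\<le>n. q ^ ((n - k) * (n - k + d)) / (poch (n - k) * poch k * poch (n - k + d)))"
      by (rule sum.reindex_bij_witness[where i = "\<lambda>k. n - k" and j = "\<lambda>k. n - k"]) auto
    also have "\<dots> = (\<Sum>k\<le>n. q ^ ((n - k) * (c - k)) / (poch k * poch (n - k) * poch (c - k)))"
      by (intro sum.cong refl) (simp add: c mult_ac)
    finally show ?thesis .
  qed
  show ?thesis
  proof (cases "n \<le> c")
    case True
    then show ?thesis using *[of n c] by (simp add: min_def)
  next
    case False
    then show ?thesis using *[of c n] by (simp add: min_def mult_ac)
  qed
qed

text \<open>
  The limit \<open>N \<rightarrow> \<infinity>\<close> in a finite identity with \<open>q\<close>-binomial coefficients: the quotient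
  \<open>(q)\<^sub>N / (q)\<^sub>N\<^sub>-\<^sub>n\<close> tends to \<open>1\<close> and is bounded uniformly in \<open>N\<close> and \<open>n\<close>.
\<close>

lemma tannery_poch:
  assumes "summable (\<lambda>n. norm (u n))"
  shows "(\<lambda>N. \<Sum>n\<le>N. poch N / poch (N - n) * u n) \<longlonglongrightarrow> (\<Sum>n. u n)"
proof -
  obtain K where K: "K \<ge> 1" "\<And>n. norm (poch n) \<le> K" "\<And>n. norm (1 / poch n) \<le> K"
    using poch_bounds by blast
  let ?a = "\<lambda>n N. if n \<le> N then poch N / poch (N - n) * u n else 0"
  have lim: "(\<lambda>N. ?a n N) \<longlonglongrightarrow> u n" for n
  proof -
    have "(\<lambda>N. poch (N + n) / poch N * u n) \<longlonglongrightarrow> qpoch_inf q q / qpoch_inf q q * u n"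
      by (intro tendsto_intros qpoch_tendsto LIMSEQ_ignore_initial_segment) auto
    then have "(\<lambda>N. ?a n (N + n)) \<longlonglongrightarrow> u n"
      by simp
    then show ?thesis
      by (rule LIMSEQ_offset)
  qed
  have bound: "norm (?a n N) \<le> K * K * norm (u n)" for n N
  proof -
    have "norm (poch N / poch (N - n)) \<le> K * K"
      using mult_mono[OF K(2)[of N] K(3)[of "N - n"]] K(1) by (simp add: norm_divide)
    then have "norm (poch N / poch (N - n) * u n) \<le> K * K * norm (u n)"
      by (simp add: norm_mult mult_right_mono del: times_divide_eq_left)
    then show ?thesis
      using K(1) by auto
  qed
  have "eventually (\<lambda>(n, N). norm (?a n N) \<le> K * K * norm (u n)) (sequentially \<times>\<^sub>F sequentially)"
    by (intro always_eventually) (use bound in \<open>simp only: split_paired_All case_prod_conv, blast\<close>)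
  then have "(\<lambda>N. suminf (\<lambda>n. ?a n N)) \<longlonglongrightarrow> suminf u"
    using tannerys_theorem[of ?a u sequentially "\<lambda>n. K * K * norm (u n)", OF lim] summable_mult[OF assms]
    by simp
  moreover have "suminf (\<lambda>n. ?a n N) = (\<Sum>n\<le>N. poch N / poch (N - n) * u n)" for N
    by (subst suminf_finite[of "{..N}"]) auto
  ultimately show ?thesis
    by simp
qed

text \<open>
  The limit \<open>N \<rightarrow> \<infinity>\<close> of the finite expansion. A partition is cut into its largest
  \<open>n \<times> (n + d)\<close> rectangle and the two partitions beside it.
\<close>

lemma durfee_rectangle:
  "((\<lambda>n. q ^ (n * (n + d)) / (poch n * poch (n + d))) has_sum 1 / qpoch_inf q q) UNIV"
proof -
  let ?u = "\<lambda>n. q ^ (n * (n + d)) / (poch n * poch (n + d))"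
  obtain K where K: "K \<ge> 1" "\<And>n. norm (1 / poch n) \<le> K"
    using poch_bounds by metis
  have summ: "summable (\<lambda>n. norm (?u n))"
  proof (rule summable_comparison_test')
    show "summable (\<lambda>n. K * K * norm q ^ n)"
      using norm_q_less_1 by (intro summable_mult summable_geometric) auto
    fix n :: nat
    have "norm (?u n) = norm q ^ (n * (n + d)) * (norm (1 / poch n) * norm (1 / poch (n + d)))"
      by (simp add: norm_divide norm_mult norm_power)
    also have "\<dots> \<le> norm q ^ n * (K * K)"
    proof (intro mult_mono K)
      show "norm q ^ (n * (n + d)) \<le> norm q ^ n"
        using norm_q_less_1 by (intro power_decreasing) (cases n, auto)
    qed (use K in auto)
    finally show "norm (norm (?u n)) \<le> K * K * norm q ^ n"
      by (simp add: mult_ac)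
  qed
  have "(\<lambda>N. \<Sum>n\<le>N. poch N / poch (N - n) * ?u n) \<longlonglongrightarrow> suminf ?u"
    by (rule tannery_poch[OF summ])
  moreover have "(\<Sum>n\<le>N. poch N / poch (N - n) * ?u n) = 1 / poch (N + d)" for N
  proof -
    have "(\<Sum>n\<le>N. poch N / poch (N - n) * ?u n) =
      poch N * (\<Sum>n\<le>N. q ^ (n * (n + d)) / (poch n * poch (N - n) * poch (n + d)))"
      unfolding sum_distrib_left by (intro sum.cong refl) (simp add: mult_ac)
    then show ?thesis
      by (simp add: durfee_rectangle_finite)
  qed
  moreover have "(\<lambda>N. 1 / poch (N + d)) \<longlonglongrightarrow> 1 / qpoch_inf q q"
    by (intro tendsto_intros qpoch_tendsto LIMSEQ_ignore_initial_segment) simp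
  ultimately have "suminf ?u = 1 / qpoch_inf q q"
    using LIMSEQ_unique by fastforce
  then show ?thesis
    using norm_summable_imp_has_sum[OF summ summable_sums[OF summable_norm_cancel[OF summ]]]
    by (simp only:)
qed

text \<open>
  The \<open>q\<close>-binomial theorem, where \<open>h\<^bsup>2n\<^sup>2\<^esup> = q\<^bsup>n(n-1)/2\<^esup> h\<^bsup>2n\<^esup>\<close>. Its limit is Euler's expansion below.
\<close>

lemma finite_q_binomial:
  "qpoch (- (h\<^sup>2 * z)) q N = (\<Sum>n\<le>N. poch N / (poch n * poch (N - n)) * (h ^ (2 * n\<^sup>2) * z ^ n))"
proof (induction N)
  case 0
  then show ?case by simp
next
  case (Suc N)
  let ?e = "\<lambda>n. h ^ (2 * n\<^sup>2) * z ^ n"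
  let ?w = "\<lambda>N n. poch N / (poch n * poch (N - n))"
  have h4: "h ^ (4 * n) = q ^ n" for n
    by (simp add: power_mult h_power)
  have e_Suc: "?e (Suc n) = h\<^sup>2 * z * q ^ n * ?e n" for n
    by (simp add: h4[symmetric] power2_eq_square power_add[symmetric] algebra_simps)
  have split: "?w (Suc N) n * ?e n = (1 - q ^ (Suc N - n)) * poch N / (poch n * poch (Suc N - n)) * ?e n
      + q ^ (Suc N - n) * ((1 - q ^ n) * poch N / (poch n * poch (Suc N - n)) * ?e n)" if "n \<le> Suc N" for n
  proof -
    have "q ^ (Suc N - n) * q ^ n = q * q ^ N"
      using that by (metis le_add_diff_inverse2 power_Suc power_add)
    then have *: "1 - q * q ^ N = (1 - q ^ (Suc N - n)) + q ^ (Suc N - n) * (1 - q ^ n)"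
      by (simp add: algebra_simps)
    show ?thesis
      unfolding qpoch_Suc * by (simp add: field_simps)
  qed
  have A: "(\<Sum>n\<le>Suc N. (1 - q ^ (Suc N - n)) * poch N / (poch n * poch (Suc N - n)) * ?e n)
     = (\<Sum>n\<le>N. ?w N n * ?e n)"
  proof -
    have "(\<Sum>n\<le>Suc N. (1 - q ^ (Suc N - n)) * poch N / (poch n * poch (Suc N - n)) * ?e n)
      = (\<Sum>n\<le>N. (1 - q ^ (Suc N - n)) * poch N / (poch n * poch (Suc N - n)) * ?e n)"
      by simp
    also have "\<dots> = (\<Sum>n\<le>N. ?w N n * ?e n)"
    proof (intro sum.cong refl)
      fix n assume "n \<in> {..N}"
      then have *: "Suc N - n = Suc (N - n)"
        by auto
      have "1 - q * q ^ (N - n) \<noteq> 0"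
        by (rule one_minus_q_power_nonzero)
      then show "(1 - q ^ (Suc N - n)) * poch N / (poch n * poch (Suc N - n)) * ?e n = ?w N n * ?e n"
        unfolding * by (simp add: qpoch_Suc)
    qed
    finally show ?thesis .
  qed
  have B: "(\<Sum>n\<le>Suc N. q ^ (Suc N - n) * ((1 - q ^ n) * poch N / (poch n * poch (Suc N - n)) * ?e n))
     = h\<^sup>2 * z * q ^ N * (\<Sum>n\<le>N. ?w N n * ?e n)"
  proof -
    have "(\<Sum>n\<le>Suc N. q ^ (Suc N - n) * ((1 - q ^ n) * poch N / (poch n * poch (Suc N - n)) * ?e n))
      = (\<Sum>n\<le>N. q ^ (N - n) * ((1 - q ^ Suc n) * poch N / (poch (Suc n) * poch (N - n)) * ?e (Suc n)))"
      by (subst sum.atMost_Suc_shift) simp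
    also have "\<dots> = (\<Sum>n\<le>N. h\<^sup>2 * z * q ^ N * (?w N n * ?e n))"
    proof (intro sum.cong refl)
      fix n assume "n \<in> {..N}"
      then have qN: "q ^ N = q ^ (N - n) * q ^ n"
        by (metis atMost_iff le_add_diff_inverse2 power_add)
      have "1 - q * q ^ n \<noteq> 0"
        by (rule one_minus_q_power_nonzero)
      then show "q ^ (N - n) * ((1 - q ^ Suc n) * poch N / (poch (Suc n) * poch (N - n)) * ?e (Suc n))
        = h\<^sup>2 * z * q ^ N * (?w N n * ?e n)"
        unfolding e_Suc qN by (simp add: qpoch_Suc mult_ac)
    qed
    finally show ?thesis
      by (simp add: sum_distrib_left)
  qed
  have "(\<Sum>n\<le>Suc N. ?w (Suc N) n * ?e n) =
      (\<Sum>n\<le>Suc N. (1 - q ^ (Suc N - n)) * poch N / (poch n * poch (Suc N - n)) * ?e n)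
      + (\<Sum>n\<le>Suc N. q ^ (Suc N - n) * ((1 - q ^ n) * poch N / (poch n * poch (Suc N - n)) * ?e n))"
    unfolding sum.distrib[symmetric] by (rule sum.cong[OF refl], rule split) simp
  also have "\<dots> = (\<Sum>n\<le>N. ?w N n * ?e n) + h\<^sup>2 * z * q ^ N * (\<Sum>n\<le>N. ?w N n * ?e n)"
    by (simp only: A B)
  finally have "(\<Sum>n\<le>Suc N. ?w (Suc N) n * ?e n) = \<dots>" .
  then show ?case
    unfolding qpoch_Suc[of "- (h\<^sup>2 * z)" q N] Suc.IH by (simp add: ring_distribs mult_ac del: sum.atMost_Suc)
qed

lemma euler_has_sum:
  "((\<lambda>n. h ^ (2 * n\<^sup>2) * z ^ n / poch n) has_sum qpoch_inf (- (h\<^sup>2 * z)) q) UNIV"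
proof -
  let ?u = "\<lambda>n. h ^ (2 * n\<^sup>2) * z ^ n / poch n"
  obtain K where K: "K \<ge> 1" "\<And>n. norm (1 / poch n) \<le> K"
    using poch_bounds by metis
  have summ: "summable (\<lambda>n. norm (?u n))"
  proof (rule summable_comparison_test')
    show "summable (\<lambda>n. K * (norm z ^ n * norm h ^ (2 * n\<^sup>2)))"
      using gaussian_summable[of "norm h ^ 2" "norm z"] norm_h_less_1
      by (intro summable_mult) (simp add: power_mult power_less_one_iff)
    fix n :: nat
    have "norm (?u n) = norm (1 / poch n) * (norm z ^ n * norm h ^ (2 * n\<^sup>2))"
      by (simp add: norm_divide norm_mult norm_power)
    also have "\<dots> \<le> K * (norm z ^ n * norm h ^ (2 * n\<^sup>2))"
      by (intro mult_right_mono K) simp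
    finally show "norm (norm (?u n)) \<le> K * (norm z ^ n * norm h ^ (2 * n\<^sup>2))"
      by simp
  qed
  have "(\<lambda>N. \<Sum>n\<le>N. poch N / poch (N - n) * ?u n) \<longlonglongrightarrow> suminf ?u"
    by (rule tannery_poch[OF summ])
  moreover have "(\<Sum>n\<le>N. poch N / poch (N - n) * ?u n) = qpoch (- (h\<^sup>2 * z)) q N" for N
    unfolding finite_q_binomial by (intro sum.cong refl) (simp add: mult_ac)
  ultimately have "suminf ?u = qpoch_inf (- (h\<^sup>2 * z)) q"
    using qpoch_tendsto[of "- (h\<^sup>2 * z)"] LIMSEQ_unique by simp blast
  then show ?thesis
    using norm_summable_imp_has_sum[OF summ summable_sums[OF summable_norm_cancel[OF summ]]]
    by (simp only:)
qed

end

section \<open>Sums over tuples\<close>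

lemma has_sum_product:
  fixes f :: "'a \<Rightarrow> complex" and g :: "'b \<Rightarrow> complex"
  assumes f: "(f has_sum s) A" and g: "(g has_sum t) B"
  shows "((\<lambda>(x, y). f x * g y) has_sum (s * t)) (A \<times> B)"
proof -
  have fa: "(\<lambda>x. norm (f x)) summable_on A" and ga: "(\<lambda>y. norm (g y)) summable_on B"
    using f g by (auto simp: summable_on_iff_abs_summable_on_complex[symmetric] has_sum_imp_summable)
  have "(\<lambda>z. norm (case z of (x, y) \<Rightarrow> f x * g y)) summable_on A \<times> B"
    using fa ga
    by (subst Infinite_Sum.abs_summable_on_Sigma_iff)
       (auto simp: norm_mult infsum_cmult_right' abs_mult infsum_nonneg
             intro!: summable_on_cmult_right summable_on_cmult_left)
  then have "(\<lambda>(x, y). f x * g y) summable_on A \<times> B"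
    by (simp only: summable_on_iff_abs_summable_on_complex)
  then obtain S where S: "((\<lambda>(x, y). f x * g y) has_sum S) (A \<times> B)"
    by (auto simp: summable_on_def)
  have "((\<lambda>x. f x * t) has_sum S) A"
    by (rule has_sum_SigmaD[OF S]) (simp add: has_sum_cmult_right[OF g])
  then have "S = s * t"
    using has_sum_cmult_left[OF f, of t] has_sum_unique by blast
  with S show ?thesis by simp
qed

lemma summable_on_product:
  fixes f :: "'a \<Rightarrow> complex" and g :: "'b \<Rightarrow> complex"
  assumes "f summable_on A" and "g summable_on B"
  shows "(\<lambda>(x, y). f x * g y) summable_on A \<times> B"
  using assms has_sum_product has_sum_imp_summable unfolding summable_on_def by blast

lemma tuples_eq_0: "n \<in> tuples r \<Longrightarrow> i \<notin> {1..r} \<Longrightarrow> n i = 0"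
  by (simp add: tuples_def)

lemma tuples_0 [simp]: "tuples 0 = {\<lambda>_. 0}"
  by (auto simp: tuples_def)

lemma bij_betw_tuples_Suc:
  "bij_betw (\<lambda>(m, p). m(Suc n := p)) (tuples n \<times> UNIV) (tuples (Suc n))"
  by (rule bij_betw_byWitness[where f' = "\<lambda>m. (m(Suc n := 0), m (Suc n))"])
     (auto simp: tuples_def fun_eq_iff)

lemma tuples_prod_has_sum:
  fixes f :: "nat \<Rightarrow> nat \<Rightarrow> complex"
  assumes "\<And>i. i \<in> {1..r} \<Longrightarrow> (f i has_sum s i) UNIV"
  shows "((\<lambda>m. \<Prod>i=1..r. f i (m i)) has_sum (\<Prod>i=1..r. s i)) (tuples r)"
  using assms
proof (induction r)
  case 0
  then show ?case by (simp add: has_sum_finite_iff)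
next
  case (Suc r)
  have "((\<lambda>(m, p). (\<Prod>i=1..r. f i (m i)) * f (Suc r) p) has_sum (\<Prod>i=1..r. s i) * s (Suc r))
      (tuples r \<times> UNIV)"
    using Suc.prems by (intro has_sum_product Suc.IH) auto
  also have "?this \<longleftrightarrow> ((\<lambda>z. (\<lambda>m. \<Prod>i=1..Suc r. f i (m i)) ((\<lambda>(m, p). m(Suc r := p)) z))
      has_sum (\<Prod>i=1..Suc r. s i)) (tuples r \<times> UNIV)"
    by (intro arg_cong2[where f = "\<lambda>f s. (f has_sum s) (tuples r \<times> UNIV)"])
       (auto simp: fun_eq_iff intro!: prod.cong)
  finally show ?case
    by (subst (asm) has_sum_reindex_bij_betw[OF bij_betw_tuples_Suc])
qed

lemma bij_betw_tuples_add_2: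
  "bij_betw (\<lambda>(m, (a, b)). m(2 * n + 1 := a, 2 * n + 2 := b)) (tuples (2 * n) \<times> UNIV) (tuples (2 * Suc n))"
  by (rule bij_betw_byWitness
        [where f' = "\<lambda>m. (m(2 * n + 1 := 0, 2 * n + 2 := 0), (m (2 * n + 1), m (2 * n + 2)))"])
     (auto simp: tuples_def fun_eq_iff)

lemma tuples_pair_prod_has_sum:
  fixes f :: "nat \<Rightarrow> nat \<Rightarrow> nat \<Rightarrow> complex"
  assumes "\<And>i. i \<in> {1..r} \<Longrightarrow> ((\<lambda>(a, b). f i a b) has_sum s i) UNIV"
  shows "((\<lambda>m. \<Prod>i=1..r. f i (m (2 * i - 1)) (m (2 * i))) has_sum (\<Prod>i=1..r. s i)) (tuples (2 * r))"
  using assms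
proof (induction r)
  case 0
  then show ?case by (simp add: has_sum_finite_iff)
next
  case (Suc r)
  let ?u = "\<lambda>(m, (a, b)). m(2 * r + 1 := a, 2 * r + 2 := b)"
  let ?P = "\<lambda>r m. \<Prod>i=1..r. f i (m (2 * i - 1)) (m (2 * i))"
  have "((\<lambda>(m, ab). ?P r m * (\<lambda>(a, b). f (Suc r) a b) ab)
      has_sum (\<Prod>i=1..r. s i) * s (Suc r)) (tuples (2 * r) \<times> UNIV)"
    using Suc.prems by (intro has_sum_product Suc.IH) auto
  moreover have "(\<lambda>(m, ab). ?P r m * (\<lambda>(a, b). f (Suc r) a b) ab) = (\<lambda>z. ?P (Suc r) (?u z))"
    by (auto simp: fun_eq_iff intro!: arg_cong2[where f = "(*)"] prod.cong arg_cong2[where f = "f _"])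
  ultimately have "((\<lambda>z. ?P (Suc r) (?u z)) has_sum (\<Prod>i=1..Suc r. s i)) (tuples (2 * r) \<times> UNIV)"
    by simp
  then show ?case
    by (subst (asm) has_sum_reindex_bij_betw[OF bij_betw_tuples_add_2])
qed

section \<open>The quadratic forms\<close>

lemma tadpole_form_1: "tadpole_form (Suc 0) n = (int (n 1))\<^sup>2"
  by (simp add: tadpole_form_def tadpole_def power2_eq_square)

text \<open>
  The corner entry of the tadpole matrix is \<open>1\<close>, not \<open>2\<close>, so enlarging the matrix by one row both
  raises the old corner and adds a new one. The two changes and the new off-diagonal entries form a
  complete square.
\<close>

lemma tadpole_form_Suc:
  assumes "r \<ge> 1"
  shows "tadpole_form (Suc r) n = tadpole_form r n + (int (n r) - int (n (Suc r)))\<^sup>2"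
proof -
  let ?n = "\<lambda>i. int (n i)"
  have tad: "tadpole (Suc r) i j = tadpole r i j + (if i = r \<and> j = r then 1 else 0)"
    if "i \<in> {1..r}" "j \<in> {1..r}" for i j
    using that by (auto simp: tadpole_def)
  have 1: "(\<Sum>i=1..r. \<Sum>j=1..r. ?n i * tadpole (Suc r) i j * ?n j) = tadpole_form r n + ?n r * ?n r"
  proof -
    have "(\<Sum>i=1..r. \<Sum>j=1..r. ?n i * tadpole (Suc r) i j * ?n j)
      = (\<Sum>i=1..r. \<Sum>j=1..r. ?n i * tadpole r i j * ?n j + (if i = r then if j = r then ?n r * ?n r else 0 else 0))"
      by (intro sum.cong refl) (simp add: tad algebra_simps)
    also have "\<dots> = tadpole_form r n + (\<Sum>i=1..r. \<Sum>j=1..r. (if i = r then if j = r then ?n r * ?n r else 0 else 0))"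
      by (simp add: sum.distrib tadpole_form_def)
    also have "(\<Sum>i=1..r. \<Sum>j=1..r. (if i = r then if j = r then ?n r * ?n r else 0 else 0))
       = (\<Sum>i=1..r. if i = r then ?n r * ?n r else 0)"
      using assms by (intro sum.cong refl) simp
    also have "\<dots> = ?n r * ?n r"
      using assms by simp
    finally show ?thesis .
  qed
  have 2: "(\<Sum>i=1..r. ?n i * tadpole (Suc r) i (Suc r) * ?n (Suc r)) = - (?n r * ?n (Suc r))"
  proof -
    have "(\<Sum>i=1..r. ?n i * tadpole (Suc r) i (Suc r) * ?n (Suc r))
       = (\<Sum>i=1..r. if i = r then - (?n r * ?n (Suc r)) else 0)"
      by (intro sum.cong refl) (auto simp: tadpole_def)
    then show ?thesis using assms by simp
  qed
  have 3: "(\<Sum>j=1..r. ?n (Suc r) * tadpole (Suc r) (Suc r) j * ?n j) = - (?n r * ?n (Suc r))"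
  proof -
    have "(\<Sum>j=1..r. ?n (Suc r) * tadpole (Suc r) (Suc r) j * ?n j)
       = (\<Sum>j=1..r. if j = r then - (?n r * ?n (Suc r)) else 0)"
      by (intro sum.cong refl) (auto simp: tadpole_def)
    then show ?thesis using assms by simp
  qed
  have 4: "tadpole (Suc r) (Suc r) (Suc r) = 1"
    by (simp add: tadpole_def)
  have "tadpole_form (Suc r) n = (\<Sum>i=1..r. \<Sum>j=1..r. ?n i * tadpole (Suc r) i j * ?n j)
      + (\<Sum>i=1..r. ?n i * tadpole (Suc r) i (Suc r) * ?n (Suc r))
      + (\<Sum>j=1..r. ?n (Suc r) * tadpole (Suc r) (Suc r) j * ?n j)
      + ?n (Suc r) * tadpole (Suc r) (Suc r) (Suc r) * ?n (Suc r)"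
    by (simp add: tadpole_form_def sum.distrib)
  then show ?thesis
    unfolding 1 2 3 4 by (simp add: power2_eq_square algebra_simps)
qed

lemma tadpole_form_odd:
  "tadpole_form (2 * r + 1) n = (int (n 1))\<^sup>2 +
     (\<Sum>i=1..r. (int (n (2 * i - 1)) - int (n (2 * i)))\<^sup>2 + (int (n (2 * i)) - int (n (2 * i + 1)))\<^sup>2)"
proof (induction r)
  case 0
  then show ?case by (simp add: tadpole_form_1)
next
  case (Suc r)
  have "tadpole_form (2 * Suc r + 1) n = tadpole_form (2 * r + 1) n
     + (int (n (2 * r + 1)) - int (n (2 * r + 2)))\<^sup>2 + (int (n (2 * r + 2)) - int (n (2 * r + 3)))\<^sup>2"
    using tadpole_form_Suc[of "2 * r + 1" n] tadpole_form_Suc[of "2 * r + 2" n]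
    by (simp add: numeral_3_eq_3)
  then show ?case
    using Suc by (simp add: numeral_3_eq_3)
qed

lemma prod_odd_pairs_first:
  fixes F :: "nat \<Rightarrow> 'a :: comm_monoid_mult"
  shows "(\<Prod>j=1..2 * r + 1. F j) = F 1 * (\<Prod>i=1..r. F (2 * i) * F (2 * i + 1))"
  by (induction r) (simp_all add: mult_ac)

lemma prod_odd_pairs_last:
  fixes F :: "nat \<Rightarrow> 'a :: comm_monoid_mult"
  shows "(\<Prod>j=1..2 * r + 1. F j) = (\<Prod>i=1..r. F (2 * i - 1) * F (2 * i)) * F (2 * r + 1)"
  by (induction r) (simp_all add: mult_ac)

text \<open>
  The substitution \<open>n\<^sub>j = m\<^sub>j + k\<^bsub>j div 2\<^esub>\<close> gives \<open>n\<^sub>2\<^sub>i\<close> and \<open>n\<^sub>2\<^sub>i\<^sub>+\<^sub>1\<close> the same shift \<open>k\<^sub>i\<close>, so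
  their difference is \<open>m\<^sub>2\<^sub>i - m\<^sub>2\<^sub>i\<^sub>+\<^sub>1\<close>, and \<open>2 (a - b)\<^sup>2 + 4 a b = 2 a\<^sup>2 + 2 b\<^sup>2\<close>. Here and below
  exponents are those of \<open>h\<close>, that is, four times those of \<open>q\<close>.
\<close>

lemma chain_form_decoupled:
  fixes m k :: "nat \<Rightarrow> int"
  defines "n \<equiv> \<lambda>j. m j + k (j div 2)"
  assumes "k 0 = 0"
  shows "2 * ((n 1)\<^sup>2 + (\<Sum>i=1..r. (n (2 * i - 1) - n (2 * i))\<^sup>2 + (n (2 * i) - n (2 * i + 1))\<^sup>2))
      + (\<Sum>i=1..r. 4 * (m (2 * i) * m (2 * i + 1)))
    = (\<Sum>i=1..r. 2 * (m (2 * i - 1))\<^sup>2 + 2 * (m (2 * i))\<^sup>2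
          + 2 * (m (2 * i - 1) - m (2 * i) + k (i - 1) - k i)\<^sup>2) + 2 * (m (2 * r + 1))\<^sup>2"
proof (induction r)
  case 0
  then show ?case using assms by simp
next
  case (Suc r)
  have n: "n (2 * Suc r - 1) = m (2 * r + 1) + k r" "n (2 * Suc r) = m (2 * r + 2) + k (Suc r)"
    "n (2 * Suc r + 1) = m (2 * r + 3) + k (Suc r)"
    by (simp_all add: n_def numeral_3_eq_3)
  have S: "(\<Sum>i=1..Suc r. f i) = (\<Sum>i=1..r. f i) + f (Suc r)" for f :: "nat \<Rightarrow> int"
    by simp
  have idx: "2 * Suc r = 2 * r + 2" "2 * r + 2 - 1 = 2 * r + 1" "2 * r + 2 + 1 = 2 * r + 3"
    by simp_all
  have "2 * ((m (2 * r + 1) + k r - (m (2 * r + 2) + k (Suc r)))\<^sup>2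
          + (m (2 * r + 2) + k (Suc r) - (m (2 * r + 3) + k (Suc r)))\<^sup>2)
      + 4 * (m (2 * r + 2) * m (2 * r + 3)) + 2 * (m (2 * r + 1))\<^sup>2
    = 2 * (m (2 * r + 1))\<^sup>2 + 2 * (m (2 * r + 2))\<^sup>2
      + 2 * (m (2 * r + 1) - m (2 * r + 2) + k r - k (Suc r))\<^sup>2 + 2 * (m (2 * r + 3))\<^sup>2"
    by (simp add: power2_eq_square algebra_simps)
  then show ?case
    using Suc.IH unfolding S n diff_Suc_1 unfolding idx distrib_left by linarith
qed

text \<open>
  A sequence starting at \<open>0\<close> is controlled by its increments. The constant is crude, but only its
  existence matters: the increments are all that the exponent sees of \<open>k\<close>.
\<close>

lemma sum_squares_le_sum_difference_squares:
  fixes k :: "nat \<Rightarrow> int"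
  assumes "k 0 = 0"
  shows "(\<Sum>i=1..r. (k i)\<^sup>2) \<le> 3 ^ r * (\<Sum>i=1..r. (k (i - 1) - k i)\<^sup>2)"
proof (induction r)
  case 0
  then show ?case by simp
next
  case (Suc r)
  let ?S = "\<Sum>i=1..r. (k i)\<^sup>2" and ?D = "\<Sum>i=1..r. (k (i - 1) - k i)\<^sup>2" and ?d = "(k r - k (Suc r))\<^sup>2"
  have "(k r)\<^sup>2 \<le> ?S"
  proof (cases r)
    case 0
    then show ?thesis using assms by simp
  next
    case (Suc r')
    then show ?thesis by (simp add: sum_nonneg)
  qed
  moreover have "(k (Suc r))\<^sup>2 \<le> 2 * (k r)\<^sup>2 + 2 * ?d"
  proof -
    have "0 \<le> (2 * k r - k (Suc r))\<^sup>2" by simp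
    then show ?thesis by (simp add: power2_eq_square algebra_simps)
  qed
  ultimately have "?S + (k (Suc r))\<^sup>2 \<le> 3 * ?S + 2 * ?d"
    by simp
  also have "\<dots> \<le> 3 * (3 ^ r * ?D) + 3 ^ Suc r * ?d"
  proof -
    have "(2::int) \<le> 3 ^ Suc r"
      unfolding power_Suc using one_le_power[of "3::int" r] by linarith
    then show ?thesis
      using Suc.IH by (intro add_mono mult_right_mono) auto
  qed
  finally show ?case
    by (simp add: algebra_simps)
qed

section \<open>The decoupled family and its absolute convergence\<close>

lemma prod_power_int:
  fixes z :: "'a :: field"
  assumes "z \<noteq> 0" "finite I"
  shows "(\<Prod>i\<in>I. z powi e i) = z powi (\<Sum>i\<in>I. e i)"
  using assms(2) by (induction I) (simp_all add: assms(1) power_int_add)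

lemma summable_on_of_real_complex_iff:
  "(\<lambda>z. complex_of_real (f z)) summable_on A \<longleftrightarrow> f summable_on A"
  using summable_on_Re[of "\<lambda>z. complex_of_real (f z)" A] summable_on_of_real[of f A, where 'a = complex]
  by auto

context quarter_nome
begin

lemma h_powi_4: "h powi (4 * int n) = q ^ n"
  using power_int_of_nat[of h "4 * n"] by (simp add: power_mult h_power)

definition block_exponent :: "nat \<Rightarrow> nat \<Rightarrow> nat \<Rightarrow> nat \<Rightarrow> int" where
  "block_exponent a b M N =
     2 * (int M)\<^sup>2 + 2 * (int N)\<^sup>2 + 2 * (int M - int N + int a - int b)\<^sup>2"

text \<open>
  The part of the substituted summand that depends on a pair \<open>(M, N) = (m\<^sub>2\<^sub>i\<^sub>-\<^sub>1, m\<^sub>2\<^sub>i)\<close>, where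
  \<open>a = k\<^sub>i\<^sub>-\<^sub>1\<close> and \<open>b = k\<^sub>i\<close> are the shifts of the two variables.
\<close>

definition block :: "complex \<Rightarrow> complex \<Rightarrow> nat \<Rightarrow> nat \<Rightarrow> nat \<Rightarrow> nat \<Rightarrow> complex" where
  "block u v a b M N =
     h powi block_exponent a b M N * u ^ (M + a) * v ^ (N + b) / (poch M * poch N)"

text \<open>
  The whole substituted summand except for the factor that belongs to \<open>m\<^sub>2\<^sub>r\<^sub>+\<^sub>1\<close>. That factor sums to an
  infinite product which can be zero, so it is kept apart: convergence of the remaining sum over \<open>k\<close>
  could not be recovered from a product with it.
\<close>

definition decoupled :: "nat \<Rightarrow> (nat \<Rightarrow> complex) \<Rightarrow> (nat \<Rightarrow> nat) \<Rightarrow> (nat \<Rightarrow> nat) \<Rightarrow> complex" where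
  "decoupled r x m k =
     x (2 * r + 1) ^ k r / (\<Prod>i=1..r. poch (k i)) *
     (\<Prod>i=1..r. block (x (2 * i - 1)) (x (2 * i)) (k (i - 1)) (k i) (m (2 * i - 1)) (m (2 * i)))"

definition gaussian_term :: "real \<Rightarrow> real \<Rightarrow> nat \<Rightarrow> real" where
  "gaussian_term A \<sigma> n = A ^ n * \<sigma> ^ n\<^sup>2"

lemma gaussian_term_summable:
  assumes "0 < \<sigma>" "\<sigma> < 1"
  shows "(\<lambda>n. complex_of_real (gaussian_term A \<sigma> n)) summable_on UNIV"
proof (rule norm_summable_imp_summable_on)
  have "norm (complex_of_real (gaussian_term A \<sigma> n)) = \<bar>A\<bar> ^ n * \<sigma> ^ n\<^sup>2" for n
    using assms by (simp add: gaussian_term_def norm_mult norm_power)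
  then show "summable (\<lambda>n. norm (complex_of_real (gaussian_term A \<sigma> n)))"
    using gaussian_summable[OF assms, of "\<bar>A\<bar>"] by simp
qed

lemma gaussian_term_has_sum:
  assumes "0 < \<sigma>" "\<sigma> < 1"
  obtains S where "((\<lambda>n. complex_of_real (gaussian_term A \<sigma> n)) has_sum S) UNIV"
  using gaussian_term_summable[OF assms] by (auto simp: summable_on_def)

lemma norm_block_le:
  assumes K: "K \<ge> 1" "\<And>n. norm (1 / poch n) \<le> K"
    and A: "norm u \<le> A" "norm v \<le> A"
  shows "norm (block u v a b M N) \<le> K\<^sup>2 * (norm h powi block_exponent a b M N * A ^ (M + a) * A ^ (N + b))"
proof -
  have A0: "0 \<le> A"
    using A(1) norm_ge_zero order_trans by blast
  have "norm (block u v a b M N) = (norm (1 / poch M) * norm (1 / poch N)) *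
     (norm h powi block_exponent a b M N * norm u ^ (M + a) * norm v ^ (N + b))"
    by (simp add: block_def norm_mult norm_divide norm_power norm_power_int)
  also have "\<dots> \<le> (K * K) * (norm h powi block_exponent a b M N * A ^ (M + a) * A ^ (N + b))"
    using K A A0 by (intro mult_mono power_mono mult_nonneg_nonneg) auto
  finally show ?thesis
    by (simp add: power2_eq_square)
qed

text \<open>
  By \<open>sum_squares_le_sum_difference_squares\<close> the total exponent is bounded below by a positive multiple
  \<open>1 / L\<close> of the sum of the squares of all variables, which yields the ratio \<open>\<sigma> = root L (norm h)\<close> of the
  dominating Gaussians.
  All other factors grow at most exponentially in the variables.
\<close>

lemma decoupled_summable:
  "(\<lambda>(m, k). decoupled r x m k) summable_on tuples (2 * r) \<times> tuples r"
proof -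
  obtain K where K: "K \<ge> 1" "\<And>n. norm (1 / poch n) \<le> K"
    using poch_bounds by metis
  define A where "A = 1 + (\<Sum>j=1..2 * r + 1. norm (x j))"
  have A1: "A \<ge> 1"
    by (simp add: A_def sum_nonneg del: sum.cl_ivl_Suc)
  have A: "norm (x j) \<le> A" if "j \<in> {1..2 * r + 1}" for j
    using member_le_sum[of j "{1..2 * r + 1}" "\<lambda>j. norm (x j)"] that
    by (simp add: A_def del: sum.cl_ivl_Suc)
  define L :: nat where "L = 3 * 3 ^ r"
  define \<sigma> where "\<sigma> = root L (norm h)"
  have L: "0 < L" by (simp add: L_def)
  have \<sigma>: "0 < \<sigma>" "\<sigma> < 1" "\<sigma> ^ L = norm h"
    using norm_h_less_1 L by (simp_all add: \<sigma>_def)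
  let ?Bm = "\<lambda>m. \<Prod>i=1..r. gaussian_term A \<sigma> (m (2 * i - 1)) * gaussian_term A \<sigma> (m (2 * i))"
  let ?Bk = "\<lambda>k. \<Prod>i=1..r. gaussian_term (A\<^sup>2) \<sigma> (k i)"
  obtain S where S: "((\<lambda>n. complex_of_real (gaussian_term A \<sigma> n)) has_sum S) UNIV"
    using gaussian_term_has_sum[OF \<sigma>(1,2)] by blast
  obtain S' where S': "((\<lambda>n. complex_of_real (gaussian_term (A\<^sup>2) \<sigma> n)) has_sum S') UNIV"
    using gaussian_term_has_sum[OF \<sigma>(1,2)] by blast
  have "(\<lambda>m. complex_of_real (?Bm m)) summable_on tuples (2 * r)"
    using tuples_pair_prod_has_sum[of r "\<lambda>i a b. complex_of_real (gaussian_term A \<sigma> a * gaussian_term A \<sigma> b)" "\<lambda>_. S * S"]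
      has_sum_product[OF S S]
    by (auto simp: summable_on_def)
  moreover have "(\<lambda>k. complex_of_real (?Bk k)) summable_on tuples r"
    using tuples_prod_has_sum[of r "\<lambda>i a. complex_of_real (gaussian_term (A\<^sup>2) \<sigma> a)" "\<lambda>_. S'"] S'
    by (auto simp: summable_on_def)
  ultimately have "(\<lambda>(m, k). complex_of_real (?Bm m) * complex_of_real (?Bk k))
      summable_on tuples (2 * r) \<times> tuples r"
    by (rule summable_on_product)
  also have "(\<lambda>(m, k). complex_of_real (?Bm m) * complex_of_real (?Bk k)) =
      (\<lambda>z. complex_of_real (case z of (m, k) \<Rightarrow> ?Bm m * ?Bk k))"
    by (auto simp: fun_eq_iff)
  finally have "(\<lambda>(m, k). ?Bm m * ?Bk k) summable_on tuples (2 * r) \<times> tuples r"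
    by (simp only: summable_on_of_real_complex_iff)
  then have major: "(\<lambda>z. K ^ (3 * r) * (case z of (m, k) \<Rightarrow> ?Bm m * ?Bk k)) summable_on tuples (2 * r) \<times> tuples r"
    by (rule summable_on_cmult_right)
  have bound: "norm (decoupled r x m k) \<le> K ^ (3 * r) * (?Bm m * ?Bk k)"
    if k: "k \<in> tuples r" for m k
  proof -
    let ?E = "\<lambda>i. block_exponent (k (i - 1)) (k i) (m (2 * i - 1)) (m (2 * i))"
    let ?Q = "(\<Sum>i=1..r. (m (2 * i - 1))\<^sup>2 + (m (2 * i))\<^sup>2) + (\<Sum>i=1..r. (k i)\<^sup>2)"
    have k0: "k 0 = 0"
      using k by (rule tuples_eq_0) simp
    have E_nonneg: "?E i \<ge> 0" for i
      by (simp add: block_exponent_def)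
    have exponent: "int ?Q \<le> int L * (\<Sum>i=1..r. ?E i)"
    proof -
      \<comment> \<open>Four times the quadratic form \<open>3 M\<^sup>2 + 3 N\<^sup>2 + 6 s\<^sup>2 - (s - D)\<^sup>2\<close> with \<open>D = M - N\<close> and \<open>s = D + a - b\<close> is written as a sum of squares.\<close>
      have one: "3 * (int M)\<^sup>2 + 3 * (int N)\<^sup>2 + (int a - int b)\<^sup>2 \<le> 3 * block_exponent a b M N" for a b M N
      proof -
        have "4 * (3 * block_exponent a b M N) = 4 * (3 * (int M)\<^sup>2 + 3 * (int N)\<^sup>2 + (int a - int b)\<^sup>2)
          + ((int M - int N + 4 * (int M - int N + int a - int b))\<^sup>2
             + 4 * (int M - int N + int a - int b)\<^sup>2 + 5 * (int M + int N)\<^sup>2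
             + 2 * (int M)\<^sup>2 + 2 * (int N)\<^sup>2)" (is "_ = _ + ?rest")
          unfolding block_exponent_def by (simp add: power2_eq_square algebra_simps)
        moreover have "?rest \<ge> 0"
          by (intro add_nonneg_nonneg mult_nonneg_nonneg) simp_all
        moreover have "u \<le> v" if "4 * v = 4 * u + w" "w \<ge> 0" for u v w :: int
          using that by linarith
        ultimately show ?thesis
          by blast
      qed
      have "int ?Q = (\<Sum>i=1..r. (int (m (2 * i - 1)))\<^sup>2 + (int (m (2 * i)))\<^sup>2) + (\<Sum>i=1..r. (int (k i))\<^sup>2)"
        by simp
      also have "\<dots> \<le> 3 ^ r * (\<Sum>i=1..r. 3 * (int (m (2 * i - 1)))\<^sup>2 + 3 * (int (m (2 * i)))\<^sup>2)
           + 3 ^ r * (\<Sum>i=1..r. (int (k (i - 1)) - int (k i))\<^sup>2)"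
      proof (rule add_mono)
        show "(\<Sum>i=1..r. (int (k i))\<^sup>2) \<le> 3 ^ r * (\<Sum>i=1..r. (int (k (i - 1)) - int (k i))\<^sup>2)"
          using sum_squares_le_sum_difference_squares[of "\<lambda>i. int (k i)" r] k0 by simp
        have "(1::int) * (\<Sum>i=1..r. (int (m (2 * i - 1)))\<^sup>2 + (int (m (2 * i)))\<^sup>2)
           \<le> 3 ^ r * (\<Sum>i=1..r. 3 * (int (m (2 * i - 1)))\<^sup>2 + 3 * (int (m (2 * i)))\<^sup>2)"
          by (intro mult_mono sum_mono sum_nonneg) auto
        then show "(\<Sum>i=1..r. (int (m (2 * i - 1)))\<^sup>2 + (int (m (2 * i)))\<^sup>2)
           \<le> 3 ^ r * (\<Sum>i=1..r. 3 * (int (m (2 * i - 1)))\<^sup>2 + 3 * (int (m (2 * i)))\<^sup>2)"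
          by simp
      qed
      also have "\<dots> = 3 ^ r * (\<Sum>i=1..r. 3 * (int (m (2 * i - 1)))\<^sup>2 + 3 * (int (m (2 * i)))\<^sup>2
           + (int (k (i - 1)) - int (k i))\<^sup>2)"
        by (simp only: sum.distrib distrib_left)
      also have "\<dots> \<le> 3 ^ r * (\<Sum>i=1..r. 3 * ?E i)"
        by (intro mult_left_mono sum_mono one) auto
      also have "\<dots> = int L * (\<Sum>i=1..r. ?E i)"
        by (simp add: L_def sum_distrib_left mult_ac)
      finally show ?thesis .
    qed
    have hE: "norm h powi (\<Sum>i=1..r. ?E i) \<le> \<sigma> ^ ?Q"
    proof -
      obtain e where e: "(\<Sum>i=1..r. ?E i) = int e"
        using nonneg_int_cases[OF sum_nonneg[of "{1..r}" ?E, OF E_nonneg]] by blast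
      have "?Q \<le> L * e"
        using exponent unfolding e by (simp only: of_nat_mult[symmetric] of_nat_le_iff)
      have "norm h powi (\<Sum>i=1..r. ?E i) = \<sigma> ^ (L * e)"
        unfolding e by (simp add: \<sigma>(3)[symmetric] power_mult)
      also have "\<dots> \<le> \<sigma> ^ ?Q"
        using \<open>?Q \<le> L * e\<close> \<sigma> by (intro power_decreasing) simp_all
      finally show ?thesis .
    qed
    have "norm (\<Prod>i=1..r. block (x (2 * i - 1)) (x (2 * i)) (k (i - 1)) (k i) (m (2 * i - 1)) (m (2 * i)))
      \<le> (\<Prod>i=1..r. K\<^sup>2 * (norm h powi ?E i * A ^ (m (2 * i - 1) + k (i - 1)) * A ^ (m (2 * i) + k i)))"
      unfolding prod_norm[symmetric]
      by (intro prod_mono conjI norm_ge_zero norm_block_le K A) auto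
    also have "\<dots> = K ^ (2 * r) * (norm h powi (\<Sum>i=1..r. ?E i)
        * (\<Prod>i=1..r. A ^ (m (2 * i - 1) + m (2 * i))) * (\<Prod>i=1..r. A ^ k (i - 1)) * (\<Prod>i=1..r. A ^ k i))"
      unfolding power_mult[of K 2 r] by (simp add: prod.distrib prod_power_int power_add mult_ac)
    also have "\<dots> \<le> K ^ (2 * r) * (\<sigma> ^ ?Q
        * (\<Prod>i=1..r. A ^ (m (2 * i - 1) + m (2 * i))) * (\<Prod>i=1..r. A ^ k (i - 1)) * (\<Prod>i=1..r. A ^ k i))"
      using K(1) A1 by (intro mult_left_mono mult_right_mono hE prod_nonneg mult_nonneg_nonneg) auto
    finally have blocks: "norm (\<Prod>i=1..r. block (x (2 * i - 1)) (x (2 * i)) (k (i - 1)) (k i) (m (2 * i - 1)) (m (2 * i)))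
        \<le> \<dots>" .
    have inv: "norm (1 / (\<Prod>i=1..r. poch (k i))) \<le> K ^ r"
    proof -
      have "norm (1 / (\<Prod>i=1..r. poch (k i))) = (\<Prod>i=1..r. norm (1 / poch (k i)))"
        by (simp add: norm_divide prod_dividef prod_norm)
      also have "\<dots> \<le> (\<Prod>i=1..r. K)"
        by (intro prod_mono conjI norm_ge_zero K)
      finally show ?thesis by simp
    qed
    have "norm (decoupled r x m k) = norm (1 / (\<Prod>i=1..r. poch (k i))) * norm (x (2 * r + 1)) ^ k r *
       norm (\<Prod>i=1..r. block (x (2 * i - 1)) (x (2 * i)) (k (i - 1)) (k i) (m (2 * i - 1)) (m (2 * i)))"
      by (simp add: decoupled_def norm_mult norm_divide norm_power)
    also have "\<dots> \<le> K ^ r * A ^ k r * (K ^ (2 * r) * (\<sigma> ^ ?Q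
        * (\<Prod>i=1..r. A ^ (m (2 * i - 1) + m (2 * i))) * (\<Prod>i=1..r. A ^ k (i - 1)) * (\<Prod>i=1..r. A ^ k i)))"
      using K(1) A1 A by (intro mult_mono inv blocks power_mono mult_nonneg_nonneg) auto
    also have "\<dots> = K ^ (3 * r) * (\<sigma> ^ ?Q * (\<Prod>i=1..r. A ^ (m (2 * i - 1) + m (2 * i)))
        * ((\<Prod>i=1..r. A ^ k (i - 1)) * A ^ k r) * (\<Prod>i=1..r. A ^ k i))"
      using power_add[of K r "2 * r"] by (simp add: mult_ac)
    \<comment> \<open>The powers from the left ends of the blocks and from \<open>x\<^sub>2\<^sub>r\<^sub>+\<^sub>1\<close> match those from the right ends because \<open>k 0 = 0\<close>.\<close>
    also have "(\<Prod>i=1..r. A ^ k (i - 1)) * A ^ k r = (\<Prod>i=1..r. A ^ k i)"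
      using k0 by (induction r) simp_all
    also have "K ^ (3 * r) * (\<sigma> ^ ?Q * (\<Prod>i=1..r. A ^ (m (2 * i - 1) + m (2 * i)))
        * (\<Prod>i=1..r. A ^ k i) * (\<Prod>i=1..r. A ^ k i)) = K ^ (3 * r) * (?Bm m * ?Bk k)"
      by (simp add: gaussian_term_def prod.distrib power_add power_sum power2_eq_square power_mult_distrib mult_ac)
    finally show ?thesis .
  qed
  have "(\<lambda>z. norm (case z of (m, k) \<Rightarrow> decoupled r x m k)) summable_on tuples (2 * r) \<times> tuples r"
    by (rule Infinite_Sum.abs_summable_on_comparison_test'[OF major]) (use bound in auto)
  then show ?thesis
    by (simp only: summable_on_iff_abs_summable_on_complex)
qed

lemma block_summable: "(\<lambda>(M, N). block u v a b M N) summable_on UNIV"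
proof -
  obtain K where K: "K \<ge> 1" "\<And>n. norm (1 / poch n) \<le> K"
    using poch_bounds by metis
  define A where "A = 1 + norm u + norm v"
  have A: "norm u \<le> A" "norm v \<le> A" "A \<ge> 1"
    by (simp_all add: A_def)
  define \<eta> where "\<eta> = norm h"
  have \<eta>: "0 < \<eta>" "\<eta> < 1"
    using norm_h_less_1 by (simp_all add: \<eta>_def)
  have "(\<lambda>(M, N). complex_of_real (gaussian_term A \<eta> M) * complex_of_real (gaussian_term A \<eta> N)) summable_on UNIV \<times> UNIV"
    by (intro summable_on_product gaussian_term_summable \<eta>)
  also have "(\<lambda>(M, N). complex_of_real (gaussian_term A \<eta> M) * complex_of_real (gaussian_term A \<eta> N)) =
      (\<lambda>z. complex_of_real (case z of (M, N) \<Rightarrow> gaussian_term A \<eta> M * gaussian_term A \<eta> N))"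
    by (auto simp: fun_eq_iff)
  finally have "(\<lambda>(M, N). gaussian_term A \<eta> M * gaussian_term A \<eta> N) summable_on UNIV"
    by (simp only: summable_on_of_real_complex_iff UNIV_Times_UNIV)
  then have major: "(\<lambda>z. (K\<^sup>2 * A ^ a * A ^ b) * (case z of (M, N) \<Rightarrow> gaussian_term A \<eta> M * gaussian_term A \<eta> N)) summable_on UNIV"
    by (rule summable_on_cmult_right)
  have bound: "norm (block u v a b M N) \<le> (K\<^sup>2 * A ^ a * A ^ b) * (gaussian_term A \<eta> M * gaussian_term A \<eta> N)" for M N
  proof -
    obtain e where e: "block_exponent a b M N = int e"
      by (metis nonneg_int_cases block_exponent_def add_nonneg_nonneg mult_nonneg_nonneg zero_le_numeral zero_le_power2)
    have "int (M\<^sup>2 + N\<^sup>2) \<le> block_exponent a b M N"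
      by (simp add: block_exponent_def)
    then have "M\<^sup>2 + N\<^sup>2 \<le> e"
      unfolding e by (simp only: of_nat_le_iff)
    then have he: "norm h powi block_exponent a b M N \<le> \<eta> ^ (M\<^sup>2 + N\<^sup>2)"
      using \<eta> unfolding e \<eta>_def[symmetric] power_int_of_nat by (intro power_decreasing) auto
    have "norm (block u v a b M N) \<le> K\<^sup>2 * (norm h powi block_exponent a b M N * A ^ (M + a) * A ^ (N + b))"
      by (rule norm_block_le[OF K A(1,2)])
    also have "\<dots> \<le> K\<^sup>2 * (\<eta> ^ (M\<^sup>2 + N\<^sup>2) * A ^ (M + a) * A ^ (N + b))"
      using K(1) A by (intro mult_left_mono mult_right_mono he) auto
    finally show ?thesis
      by (simp add: gaussian_term_def power_add mult_ac)
  qed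
  have "(\<lambda>z. norm (case z of (M, N) \<Rightarrow> block u v a b M N)) summable_on UNIV"
    by (rule Infinite_Sum.abs_summable_on_comparison_test'[OF major]) (use bound in auto)
  then show ?thesis
    by (simp only: summable_on_iff_abs_summable_on_complex)
qed

section \<open>Decoupling a chain of odd length\<close>

text \<open>
  The summand of \<open>inverse_poch_product\<close>, extended by zero so that \<open>k\<close> ranges over a set that does not
  depend on \<open>n\<close> and \<open>c\<close>.
\<close>

definition link :: "nat \<Rightarrow> nat \<Rightarrow> nat \<Rightarrow> complex" where
  "link n c k =
     (if k \<le> n \<and> k \<le> c then q ^ ((n - k) * (c - k)) / (poch k * poch (n - k) * poch (c - k)) else 0)"

lemma link_has_sum: "(link n c has_sum 1 / (poch n * poch c)) UNIV"
  by (rule has_sum_finite_neutralI[where B = "{..min n c}"]) (auto simp: link_def inverse_poch_product)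

definition linked_term :: "nat \<Rightarrow> (nat \<Rightarrow> complex) \<Rightarrow> (nat \<Rightarrow> nat) \<Rightarrow> (nat \<Rightarrow> nat) \<Rightarrow> complex" where
  "linked_term r x n k =
     h powi (2 * tadpole_form (2 * r + 1) n) * (\<Prod>j=1..2 * r + 1. x j ^ n j) / poch (n 1) *
     (\<Prod>i=1..r. link (n (2 * i)) (n (2 * i + 1)) (k i))"

lemma linked_term_eq_0:
  assumes "i \<in> {1..r}" and "\<not> (k i \<le> n (2 * i) \<and> k i \<le> n (2 * i + 1))"
  shows "linked_term r x n k = 0"
proof -
  have "link (n (2 * i)) (n (2 * i + 1)) (k i) = 0"
    using assms(2) by (simp only: link_def if_False)
  then have "(\<Prod>i=1..r. link (n (2 * i)) (n (2 * i + 1)) (k i)) = 0"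
    using assms(1) by (intro prod_zero) auto
  then show ?thesis
    by (simp only: linked_term_def mult_zero_right)
qed

lemma qpow_half_int: "qpow h (1/2 * of_int a) = h powi (2 * a)"
proof -
  have "4 * (1/2 * real_of_int a) = real_of_int (2 * a)" by simp
  then show ?thesis by (simp only: qpow_def floor_of_int)
qed

lemma linked_term_has_sum:
  "((\<lambda>k. linked_term r x n k) has_sum nahm_term q h (2 * r + 1) x n) (tuples r)"
proof -
  have "((\<lambda>k. linked_term r x n k) has_sum
      h powi (2 * tadpole_form (2 * r + 1) n) * (\<Prod>j=1..2 * r + 1. x j ^ n j) / poch (n 1) *
      (\<Prod>i=1..r. 1 / (poch (n (2 * i)) * poch (n (2 * i + 1))))) (tuples r)"
    unfolding linked_term_def
    by (intro has_sum_cmult_right tuples_prod_has_sum link_has_sum)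
  moreover have "(\<Prod>j=1..2 * r + 1. poch (n j)) = poch (n 1) * (\<Prod>i=1..r. poch (n (2 * i)) * poch (n (2 * i + 1)))"
    by (rule prod_odd_pairs_first)
  ultimately show ?thesis
    unfolding nahm_term_def qpow_half_int by (simp add: prod_dividef del: prod.cl_ivl_Suc)
qed

text \<open>
  The substitution \<open>n\<^sub>j = m\<^sub>j + k\<^bsub>j div 2\<^esub>\<close>, with the last coordinate \<open>p = m\<^sub>2\<^sub>r\<^sub>+\<^sub>1\<close> as a separate argument.
  Since \<open>k 0 = 0\<close>, the first variable is not shifted.
\<close>

definition add_links :: "nat \<Rightarrow> ((nat \<Rightarrow> nat) \<times> (nat \<Rightarrow> nat)) \<times> nat \<Rightarrow> (nat \<Rightarrow> nat) \<times> (nat \<Rightarrow> nat)" where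
  "add_links r = (\<lambda>((m, k), p). (\<lambda>j. (m(2 * r + 1 := p)) j + k (j div 2), k))"

lemma bij_betw_add_links:
  "bij_betw (add_links r) ((tuples (2 * r) \<times> tuples r) \<times> UNIV)
     {(n, k) \<in> tuples (2 * r + 1) \<times> tuples r. \<forall>i\<in>{1..r}. k i \<le> n (2 * i) \<and> k i \<le> n (2 * i + 1)}"
  (is "bij_betw _ ?A ?B")
proof (rule bij_betw_byWitness
    [where f' = "\<lambda>(n, k). ((\<lambda>j. if j \<in> {1..2 * r} then n j - k (j div 2) else 0, k), n (2 * r + 1) - k r)"])
  let ?g = "\<lambda>(n, k). ((\<lambda>j. if j \<in> {1..2 * r} then n j - k (j div 2) else 0 :: nat, k), n (2 * r + 1) - k r)"
  show "\<forall>z\<in>?A. ?g (add_links r z) = z"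
    by (auto simp: add_links_def tuples_def fun_eq_iff)
  show "add_links r ` ?A \<subseteq> ?B"
  proof
    fix z assume "z \<in> add_links r ` ?A"
    then obtain m k p where z: "z = add_links r ((m, k), p)" and m: "m \<in> tuples (2 * r)" and k: "k \<in> tuples r"
      by auto
    have "(m(2 * r + 1 := p)) j + k (j div 2) = 0" if "j \<notin> {1..2 * r + 1}" for j
    proof -
      have "j div 2 \<notin> {1..r}"
        using that by auto
      then show ?thesis
        using that tuples_eq_0[OF m, of j] tuples_eq_0[OF k, of "j div 2"] by auto
    qed
    then have "(\<lambda>j. (m(2 * r + 1 := p)) j + k (j div 2)) \<in> tuples (2 * r + 1)"
      unfolding tuples_def by blast
    then show "z \<in> ?B"
      using k unfolding z by (auto simp: add_links_def)
  qed
  show "?g ` ?B \<subseteq> ?A"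
    by (auto simp: tuples_def)
  show "\<forall>z\<in>?B. add_links r (?g z) = z"
  proof
    fix z assume "z \<in> ?B"
    then obtain n k where z: "z = (n, k)" and n: "n \<in> tuples (2 * r + 1)" and k: "k \<in> tuples r"
      and le: "\<And>i. i \<in> {1..r} \<Longrightarrow> k i \<le> n (2 * i) \<and> k i \<le> n (2 * i + 1)"
      by auto
    have k_le: "k (j div 2) \<le> n j" for j
    proof (cases "j div 2 \<in> {1..r}")
      case True
      have "j = 2 * (j div 2) \<or> j = 2 * (j div 2) + 1"
        by presburger
      then show ?thesis
        using le[OF True] by metis
    next
      case False
      then show ?thesis
        using tuples_eq_0[OF k] by simp
    qed
    have "((\<lambda>j. if j \<in> {1..2 * r} then n j - k (j div 2) else 0)(2 * r + 1 := n (2 * r + 1) - k r)) j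
        + k (j div 2) = n j" for j
    proof -
      have "n j = 0 \<and> k (j div 2) = 0" if "j \<notin> {1..2 * r + 1}"
        using tuples_eq_0[OF n that] k_le[of j] by simp
      moreover have "k ((2 * r + 1) div 2) = k r"
        by simp
      ultimately show ?thesis
        using k_le[of j] k_le[of "2 * r + 1"] by (auto simp del: One_nat_def)
    qed
    then show "add_links r (?g z) = z"
      by (simp add: z add_links_def)
  qed
qed

text \<open>
  After the substitution the links contribute \<open>q\<close> to the powers \<open>m\<^sub>2\<^sub>i m\<^sub>2\<^sub>i\<^sub>+\<^sub>1\<close>, and
  \<open>chain_form_decoupled\<close> turns the exponent into the sum of those of the blocks and of \<open>m\<^sub>2\<^sub>r\<^sub>+\<^sub>1\<close>.
\<close>

lemma linked_term_add_links:
  assumes m: "m \<in> tuples (2 * r)" and k: "k \<in> tuples r"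
  shows "(case add_links r ((m, k), p) of (n, k) \<Rightarrow> linked_term r x n k) =
    decoupled r x m k * (h ^ (2 * p\<^sup>2) * x (2 * r + 1) ^ p / poch p)"
proof -
  define m' where "m' = m(2 * r + 1 := p)"
  define n where "n = (\<lambda>j. m' j + k (j div 2))"
  have k0: "k 0 = 0"
    using k by (rule tuples_eq_0) simp
  have m'_top: "m' (2 * r + 1) = p"
    by (simp add: m'_def)
  have m'_eq: "m' (2 * i - 1) = m (2 * i - 1)" "m' (2 * i) = m (2 * i)" if "i \<in> {1..r}" for i
    using that by (auto simp: m'_def)
  have n_eq: "n (2 * i - 1) = m' (2 * i - 1) + k (i - 1)" "n (2 * i) = m' (2 * i) + k i"
    "n (2 * i + 1) = m' (2 * i + 1) + k i" if "i \<in> {1..r}" for i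
  proof -
    have "(2 * i - 1) div 2 = i - 1"
      using that by (cases i) auto
    then show "n (2 * i - 1) = m' (2 * i - 1) + k (i - 1)" "n (2 * i) = m' (2 * i) + k i"
      "n (2 * i + 1) = m' (2 * i + 1) + k i"
      by (simp_all add: n_def)
  qed
  have n1: "n 1 = m' 1"
    using k0 by (simp add: n_def)
  let ?E = "\<lambda>i. block_exponent (k (i - 1)) (k i) (m (2 * i - 1)) (m (2 * i))"
  have exponent: "2 * tadpole_form (2 * r + 1) n + (\<Sum>i=1..r. 4 * int (m' (2 * i) * m' (2 * i + 1)))
      = (\<Sum>i=1..r. ?E i) + 2 * int (p\<^sup>2)"
  proof -
    have E: "(\<Sum>i=1..r. ?E i) = (\<Sum>i=1..r. 2 * (int (m' (2 * i - 1)))\<^sup>2 + 2 * (int (m' (2 * i)))\<^sup>2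
          + 2 * (int (m' (2 * i - 1)) - int (m' (2 * i)) + int (k (i - 1)) - int (k i))\<^sup>2)"
      by (intro sum.cong refl) (simp only: m'_eq block_exponent_def)
    show ?thesis
      unfolding E tadpole_form_odd
      using chain_form_decoupled[of "\<lambda>i. int (k i)" "\<lambda>j. int (m' j)" r] k0
      by (simp only: n_def m'_top of_nat_add of_nat_mult of_nat_power of_nat_0)
  qed
  have link: "(\<Prod>i=1..r. link (n (2 * i)) (n (2 * i + 1)) (k i)) =
      h powi (\<Sum>i=1..r. 4 * int (m' (2 * i) * m' (2 * i + 1))) /
      ((\<Prod>i=1..r. poch (k i)) * (\<Prod>i=1..r. poch (m' (2 * i)) * poch (m' (2 * i + 1))))"
  proof -
    have "(\<Prod>i=1..r. link (n (2 * i)) (n (2 * i + 1)) (k i)) =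
      (\<Prod>i=1..r. h powi (4 * int (m' (2 * i) * m' (2 * i + 1))) /
         (poch (k i) * (poch (m' (2 * i)) * poch (m' (2 * i + 1)))))"
      by (intro prod.cong refl) (simp only: n_eq link_def h_powi_4, simp add: mult_ac)
    also have "\<dots> = (\<Prod>i=1..r. h powi (4 * int (m' (2 * i) * m' (2 * i + 1)))) /
      ((\<Prod>i=1..r. poch (k i)) * (\<Prod>i=1..r. poch (m' (2 * i)) * poch (m' (2 * i + 1))))"
      by (simp only: prod_dividef prod.distrib)
    finally show ?thesis
      by (simp only: prod_power_int h_nonzero finite_atLeastAtMost not_False_eq_True)
  qed
  have poch: "poch (n 1) * (\<Prod>i=1..r. poch (m' (2 * i)) * poch (m' (2 * i + 1))) =
     (\<Prod>i=1..r. poch (m (2 * i - 1)) * poch (m (2 * i))) * poch p"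
  proof -
    have "poch (n 1) * (\<Prod>i=1..r. poch (m' (2 * i)) * poch (m' (2 * i + 1))) = (\<Prod>j=1..2 * r + 1. poch (m' j))"
      unfolding n1 by (rule prod_odd_pairs_first[symmetric])
    also have "\<dots> = (\<Prod>i=1..r. poch (m' (2 * i - 1)) * poch (m' (2 * i))) * poch (m' (2 * r + 1))"
      by (rule prod_odd_pairs_last)
    finally show ?thesis
      by (simp only: m'_top m'_eq cong: prod.cong)
  qed
  have mono: "(\<Prod>j=1..2 * r + 1. x j ^ n j) =
     (\<Prod>i=1..r. x (2 * i - 1) ^ (m (2 * i - 1) + k (i - 1)) * x (2 * i) ^ (m (2 * i) + k i))
       * x (2 * r + 1) ^ k r * x (2 * r + 1) ^ p"
  proof -
    have "(\<Prod>j=1..2 * r + 1. x j ^ n j) =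
      (\<Prod>i=1..r. x (2 * i - 1) ^ n (2 * i - 1) * x (2 * i) ^ n (2 * i)) * x (2 * r + 1) ^ n (2 * r + 1)"
      by (rule prod_odd_pairs_last)
    also have "n (2 * r + 1) = k r + p"
      by (simp add: n_def m'_def)
    finally show ?thesis
      by (simp only: n_eq m'_eq power_add mult.assoc cong: prod.cong)
  qed
  have blocks: "(\<Prod>i=1..r. block (x (2 * i - 1)) (x (2 * i)) (k (i - 1)) (k i) (m (2 * i - 1)) (m (2 * i))) =
     h powi (\<Sum>i=1..r. ?E i) *
     (\<Prod>i=1..r. x (2 * i - 1) ^ (m (2 * i - 1) + k (i - 1)) * x (2 * i) ^ (m (2 * i) + k i)) /
     (\<Prod>i=1..r. poch (m (2 * i - 1)) * poch (m (2 * i)))"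
    by (simp only: block_def prod_dividef prod.distrib prod_power_int[OF h_nonzero finite_atLeastAtMost] mult.assoc)
  have "linked_term r x n k =
     (h powi (2 * tadpole_form (2 * r + 1) n) * h powi (\<Sum>i=1..r. 4 * int (m' (2 * i) * m' (2 * i + 1)))) *
     (\<Prod>j=1..2 * r + 1. x j ^ n j) / (\<Prod>i=1..r. poch (k i)) /
     (poch (n 1) * (\<Prod>i=1..r. poch (m' (2 * i)) * poch (m' (2 * i + 1))))"
    unfolding linked_term_def link by (simp add: mult_ac del: prod.cl_ivl_Suc)
  also have "h powi (2 * tadpole_form (2 * r + 1) n) * h powi (\<Sum>i=1..r. 4 * int (m' (2 * i) * m' (2 * i + 1)))
      = h powi (\<Sum>i=1..r. ?E i) * h ^ (2 * p\<^sup>2)"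
  proof -
    have "h powi (2 * int (p\<^sup>2)) = h ^ (2 * p\<^sup>2)"
      using power_int_of_nat[of h "2 * p\<^sup>2"] by simp
    then show ?thesis
      by (simp only: power_int_add[symmetric] h_nonzero exponent simp_thms)
         (simp only: power_int_add h_nonzero simp_thms)
  qed
  finally have "linked_term r x n k = decoupled r x m k * (h ^ (2 * p\<^sup>2) * x (2 * r + 1) ^ p / poch p)"
    unfolding poch mono decoupled_def blocks by (simp add: mult_ac)
  then show ?thesis
    by (simp add: add_links_def n_def m'_def)
qed

text \<open>
  The family of all \<open>(n, k)\<close> is summed in two ways. Summing over \<open>k\<close> first gives the Nahm sum; the
  substitution turns it into the product of the decoupled family with Euler's series.
\<close>

theorem nahm_sum_odd_chain:
  "(nahm_term q h (2 * r + 1) x has_sum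
      qpoch_inf (- (h\<^sup>2 * x (2 * r + 1))) q * (\<Sum>\<^sub>\<infinity>(m, k)\<in>tuples (2 * r) \<times> tuples r. decoupled r x m k))
    (tuples (2 * r + 1))"
proof -
  let ?S = "\<Sum>\<^sub>\<infinity>(m, k)\<in>tuples (2 * r) \<times> tuples r. decoupled r x m k"
  let ?C = "{(n, k) \<in> tuples (2 * r + 1) \<times> tuples r. \<forall>i\<in>{1..r}. k i \<le> n (2 * i) \<and> k i \<le> n (2 * i + 1)}"
  let ?T = "\<lambda>(n, k). linked_term r x n k"
  have "((\<lambda>(m, k). decoupled r x m k) has_sum ?S) (tuples (2 * r) \<times> tuples r)"
    using decoupled_summable by (rule has_sum_infsum)
  then have "((\<lambda>(mk, p). (\<lambda>(m, k). decoupled r x m k) mk * (h ^ (2 * p\<^sup>2) * x (2 * r + 1) ^ p / poch p))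
      has_sum ?S * qpoch_inf (- (h\<^sup>2 * x (2 * r + 1))) q) ((tuples (2 * r) \<times> tuples r) \<times> UNIV)"
    by (intro has_sum_product euler_has_sum)
  also have "?this \<longleftrightarrow> ((\<lambda>z. ?T (add_links r z)) has_sum ?S * qpoch_inf (- (h\<^sup>2 * x (2 * r + 1))) q)
      ((tuples (2 * r) \<times> tuples r) \<times> UNIV)"
    by (intro has_sum_cong) (auto simp: linked_term_add_links)
  also have "\<dots> \<longleftrightarrow> (?T has_sum ?S * qpoch_inf (- (h\<^sup>2 * x (2 * r + 1))) q) ?C"
    by (rule has_sum_reindex_bij_betw[OF bij_betw_add_links])
  also have "\<dots> \<longleftrightarrow> (?T has_sum ?S * qpoch_inf (- (h\<^sup>2 * x (2 * r + 1))) q) (tuples (2 * r + 1) \<times> tuples r)"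
  proof (rule has_sum_cong_neutral)
    fix z assume "z \<in> tuples (2 * r + 1) \<times> tuples r - ?C"
    then show "?T z = 0"
      by (cases z) (auto simp del: One_nat_def intro: linked_term_eq_0)
  qed auto
  finally have "(?T has_sum ?S * qpoch_inf (- (h\<^sup>2 * x (2 * r + 1))) q) (tuples (2 * r + 1) \<times> tuples r)" .
  from has_sum_SigmaD[OF this] show ?thesis
    using linked_term_has_sum by (simp add: mult.commute)
qed

end

section \<open>Theta series\<close>

lemma qpow_eqI: "4 * e = of_int a \<Longrightarrow> qpow h e = h powi a"
  by (simp add: qpow_def)

text \<open>
  The theta series come with powers of the parameters whose exponents are differences of neighbouring
  indices. Summation by parts in the exponent turns them into powers of quotients of neighbouring parameters.
\<close>

lemma telescoping_powers:
  fixes y :: "nat \<Rightarrow> 'a :: field" and n :: "nat \<Rightarrow> nat"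
  assumes "\<And>i. i < s \<Longrightarrow> y i \<noteq> 0"
  shows "y s ^ n s * (\<Prod>i=1..s. y (i - 1) powi (int (n (i - 1)) - int (n i))) =
    y 0 ^ n 0 * (\<Prod>j=1..s. (y j / y (j - 1)) ^ n j)"
  using assms
proof (induction s)
  case 0
  then show ?case by simp
next
  case (Suc s)
  let ?X = "\<Prod>i=1..s. y (i - 1) powi (int (n (i - 1)) - int (n i))"
  have "y s \<noteq> 0"
    using Suc.prems by simp
  then have step: "y (Suc s) ^ n (Suc s) * (X * y s powi (int (n s) - int (n (Suc s)))) =
     (y s ^ n s * X) * (y (Suc s) / y s) ^ n (Suc s)" for X
    by (simp add: power_int_diff power_divide)
  have IH: "y s ^ n s * ?X = y 0 ^ n 0 * (\<Prod>j=1..s. (y j / y (j - 1)) ^ n j)"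
    using Suc.prems by (intro Suc.IH) simp
  have split: "(\<Prod>i=1..Suc s. f i) = (\<Prod>i=1..s. f i) * f (Suc s)" for f :: "nat \<Rightarrow> 'a"
    by simp
  show ?case
    unfolding split diff_Suc_1 step IH by (simp only: mult.assoc)
qed

context quarter_nome
begin

definition block_sum :: "complex \<Rightarrow> complex \<Rightarrow> nat \<Rightarrow> nat \<Rightarrow> complex" where
  "block_sum u v a b = (\<Sum>\<^sub>\<infinity>(M, N). block u v a b M N)"

lemma block_has_sum: "((\<lambda>(M, N). block u v a b M N) has_sum block_sum u v a b) UNIV"
  unfolding block_sum_def using block_summable by (rule has_sum_infsum)

text \<open>
  Pairs of natural numbers, sorted by their difference \<open>D\<close>; the second coordinate is their minimum.
\<close>

lemma bij_betw_difference_min: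
  "bij_betw (\<lambda>(D, n). (n + nat D, n + nat (- D))) UNIV (UNIV :: (nat \<times> nat) set)"
  by (rule bij_betw_byWitness[where f' = "\<lambda>(M, N). (int M - int N, min M N)"]) auto

text \<open>
  On pairs with difference \<open>D\<close> and minimum \<open>n\<close> the exponent splits as \<open>(2 D + e)\<^sup>2 + e\<^sup>2 + 4 M N\<close>, and
  \<open>M N = n (n + \<bar>D\<bar>)\<close> is the area of a Durfee rectangle.
\<close>

lemma block_eq_theta_times_durfee:
  fixes a b :: nat
  assumes "u * v = 1"
  defines "e \<equiv> int a - int b"
  shows "block u v a b (n + nat D) (n + nat (- D)) =
    h powi ((2 * D + e)\<^sup>2 + e\<^sup>2) * u powi (D + e) *
    (q ^ (n * (n + nat \<bar>D\<bar>)) / (poch n * poch (n + nat \<bar>D\<bar>)))"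
proof -
  let ?M = "n + nat D" and ?N = "n + nat (- D)"
  have u: "u \<noteq> 0" and v: "v = inverse u"
    using assms(1) by (auto simp: inverse_unique)
  have D: "int ?M - int ?N = D"
    by auto
  have MN: "?M * ?N = n * (n + nat \<bar>D\<bar>)"
    by (cases "D \<ge> 0") simp_all
  have poch: "poch ?M * poch ?N = poch n * poch (n + nat \<bar>D\<bar>)"
    by (cases "D \<ge> 0") simp_all
  have "block_exponent a b ?M ?N = (2 * (int ?M - int ?N) + e)\<^sup>2 + e\<^sup>2 + 4 * int (?M * ?N)"
    unfolding block_exponent_def e_def of_nat_mult by (simp only: power2_eq_square) algebra
  then have "h powi block_exponent a b ?M ?N = h powi ((2 * D + e)\<^sup>2 + e\<^sup>2) * q ^ (?M * ?N)"
    unfolding D by (simp only: power_int_add h_nonzero h_powi_4 simp_thms)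
  moreover have "u ^ (?M + a) * v ^ (?N + b) = u powi (D + e)"
  proof -
    have "u ^ (?M + a) * v ^ (?N + b) = u powi (int (?M + a)) * u powi (- int (?N + b))"
      unfolding v power_int_minus power_int_of_nat power_inverse ..
    also have "\<dots> = u powi (int (?M + a) - int (?N + b))"
      by (simp only: power_int_add[OF disjI1[OF u], symmetric] add_uminus_conv_diff)
    also have "int (?M + a) - int (?N + b) = D + e"
      using D by (simp add: e_def)
    finally show ?thesis .
  qed
  ultimately show ?thesis
    unfolding block_def poch MN by (simp add: mult.assoc)
qed

text \<open>
  Summation of the block over the minimum at fixed difference \<open>D = - l\<close>. The constant relating both sides
  is nonzero, so convergence of the theta series is inherited from that of the block sum.
\<close>

lemma theta_has_sum:
  fixes a b :: nat
  assumes "u * v = 1"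
  defines "e \<equiv> int a - int b"
  shows "((\<lambda>l. h powi (2 * l - e)\<^sup>2 * u powi (- l)) has_sum
      qpoch_inf q q / (h powi e\<^sup>2 * u powi e) * block_sum u v a b) UNIV"
proof -
  have u: "u \<noteq> 0"
    using assms(1) by auto
  define c where "c = h powi e\<^sup>2 * u powi e / qpoch_inf q q"
  have c: "c \<noteq> 0"
    using u by (simp add: c_def)
  let ?d = "\<lambda>(D, n). (n + nat D, n + nat (- D))"
  have "((\<lambda>z. (\<lambda>(M, N). block u v a b M N) (?d z)) has_sum block_sum u v a b) (UNIV \<times> UNIV)"
    using block_has_sum[of u v a b] has_sum_reindex_bij_betw[OF bij_betw_difference_min]
    unfolding UNIV_Times_UNIV by blast
  then have "((\<lambda>D. h powi ((2 * D + e)\<^sup>2 + e\<^sup>2) * u powi (D + e) * (1 / qpoch_inf q q))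
      has_sum block_sum u v a b) UNIV"
  proof (rule has_sum_SigmaD)
    fix D :: int
    show "((\<lambda>n. (\<lambda>(M, N). block u v a b M N) (?d (D, n))) has_sum
        h powi ((2 * D + e)\<^sup>2 + e\<^sup>2) * u powi (D + e) * (1 / qpoch_inf q q)) UNIV"
      unfolding case_prod_conv block_eq_theta_times_durfee[OF assms(1)] e_def
      by (intro has_sum_cmult_right durfee_rectangle)
  qed
  also have "?this \<longleftrightarrow> ((\<lambda>l. h powi ((2 * (- l) + e)\<^sup>2 + e\<^sup>2) * u powi (- l + e) * (1 / qpoch_inf q q))
      has_sum block_sum u v a b) UNIV"
    by (rule has_sum_reindex_bij_betw[symmetric]) (rule bij_uminus)
  also have "(\<lambda>l. h powi ((2 * (- l) + e)\<^sup>2 + e\<^sup>2) * u powi (- l + e) * (1 / qpoch_inf q q)) =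
      (\<lambda>l. c * (h powi (2 * l - e)\<^sup>2 * u powi (- l)))"
  proof
    fix l
    have "(2 * (- l) + e)\<^sup>2 = (2 * l - e)\<^sup>2"
      by (simp add: power2_eq_square algebra_simps)
    then show "h powi ((2 * (- l) + e)\<^sup>2 + e\<^sup>2) * u powi (- l + e) * (1 / qpoch_inf q q) =
        c * (h powi (2 * l - e)\<^sup>2 * u powi (- l))"
      using u by (simp only: power_int_add h_nonzero simp_thms c_def) simp
  qed
  finally have "((\<lambda>l. 1 / c * (c * (h powi (2 * l - e)\<^sup>2 * u powi (- l)))) has_sum 1 / c * block_sum u v a b) UNIV"
    by (rule has_sum_cmult_right)
  moreover have "(\<lambda>l. 1 / c * (c * (h powi (2 * l - e)\<^sup>2 * u powi (- l)))) = (\<lambda>l. h powi (2 * l - e)\<^sup>2 * u powi (- l))"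
    using c by simp
  moreover have "1 / c = qpoch_inf q q / (h powi e\<^sup>2 * u powi e)"
    by (simp add: c_def)
  ultimately show ?thesis
    by simp
qed

definition theta :: "complex \<Rightarrow> nat \<Rightarrow> nat \<Rightarrow> complex" where
  "theta u a b = (\<Sum>\<^sub>\<infinity>l. qpow h ((of_int l - (real a - real b) / 2)\<^sup>2) * u powi (- l))"

lemma qpow_theta_exponent:
  "qpow h ((of_int l - (real a - real b) / 2)\<^sup>2) = h powi (2 * l - (int a - int b))\<^sup>2"
  by (rule qpow_eqI) (simp add: power2_eq_square field_simps)

lemma theta_summable:
  assumes "u * v = 1"
  shows "(\<lambda>l. qpow h ((of_int l - (real a - real b) / 2)\<^sup>2) * u powi (- l)) summable_on UNIV"
  unfolding qpow_theta_exponent using theta_has_sum[OF assms, of a b] by (rule has_sum_imp_summable)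

lemma block_sum_eq_theta:
  assumes "u * v = 1"
  shows "block_sum u v a b =
    h powi (int a - int b)\<^sup>2 * u powi (int a - int b) / qpoch_inf q q * theta u a b"
proof -
  have "u \<noteq> 0"
    using assms by auto
  moreover have "theta u a b = qpoch_inf q q / (h powi (int a - int b)\<^sup>2 * u powi (int a - int b)) * block_sum u v a b"
    unfolding theta_def qpow_theta_exponent using theta_has_sum[OF assms] by (rule infsumI)
  ultimately show ?thesis
    by simp
qed

section \<open>The two formulas\<close>

lemma decoupled_swap_has_sum:
  "((\<lambda>(k, m). decoupled r x m k) has_sum (\<Sum>\<^sub>\<infinity>(m, k)\<in>tuples (2 * r) \<times> tuples r. decoupled r x m k))
     (tuples r \<times> tuples (2 * r))"
proof -
  have "((\<lambda>(m, k). decoupled r x m k) has_sum (\<Sum>\<^sub>\<infinity>(m, k)\<in>tuples (2 * r) \<times> tuples r. decoupled r x m k))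
     (tuples (2 * r) \<times> tuples r)"
    using decoupled_summable by (rule has_sum_infsum)
  then show ?thesis
    by (subst (asm) has_sum_swap) (simp add: case_prod_unfold)
qed

lemma decoupled_has_sum_block_sums:
  "((\<lambda>k. x (2 * r + 1) ^ k r / (\<Prod>i=1..r. poch (k i)) *
        (\<Prod>i=1..r. block_sum (x (2 * i - 1)) (x (2 * i)) (k (i - 1)) (k i)))
     has_sum (\<Sum>\<^sub>\<infinity>(m, k)\<in>tuples (2 * r) \<times> tuples r. decoupled r x m k)) (tuples r)"
proof (rule has_sum_SigmaD[OF decoupled_swap_has_sum])
  fix k
  show "((\<lambda>m. case (k, m) of (k, m) \<Rightarrow> decoupled r x m k) has_sum
      x (2 * r + 1) ^ k r / (\<Prod>i=1..r. poch (k i)) *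
        (\<Prod>i=1..r. block_sum (x (2 * i - 1)) (x (2 * i)) (k (i - 1)) (k i))) (tuples (2 * r))"
    unfolding case_prod_conv decoupled_def
    by (intro has_sum_cmult_right tuples_pair_prod_has_sum block_has_sum)
qed

theorem nahm_sum_odd:
  fixes x :: "nat \<Rightarrow> complex"
  assumes x: "\<And>i. i \<in> {1..r} \<Longrightarrow> x (2 * i - 1) * x (2 * i) = 1"
  defines "rhs \<equiv> \<lambda>n. qpow h (1/4 * (\<Sum>i=1..r. (real (n i) - real (n (i - 1)))\<^sup>2))
              / (\<Prod>i=1..r. poch (n i)) * (\<Prod>j=1..r. (x (2 * j + 1) / x (2 * j - 1)) ^ n j)
              * (\<Prod>k=1..r. theta (x (2 * k - 1)) (n (k - 1)) (n k))"
  shows "nahm_term q h (2 * r + 1) x summable_on tuples (2 * r + 1)"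
    and "rhs summable_on tuples r"
    and "nahm_sum q h (2 * r + 1) x =
      qpoch_inf (- (qpow h (1/2) * x (2 * r + 1))) q / qpoch_inf q q ^ r * (\<Sum>\<^sub>\<infinity>n\<in>tuples r. rhs n)"
proof -
  let ?S = "\<Sum>\<^sub>\<infinity>(m, k)\<in>tuples (2 * r) \<times> tuples r. decoupled r x m k"
  let ?P = "qpoch_inf q q ^ r"
  have rhs_eq: "rhs n = ?P * (x (2 * r + 1) ^ n r / (\<Prod>i=1..r. poch (n i)) *
        (\<Prod>i=1..r. block_sum (x (2 * i - 1)) (x (2 * i)) (n (i - 1)) (n i)))"
    if n: "n \<in> tuples r" for n
  proof -
    let ?e = "\<lambda>i. int (n (i - 1)) - int (n i)"
    have n0: "n 0 = 0"
      using n by (rule tuples_eq_0) simp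
    have "(\<Prod>i=1..r. block_sum (x (2 * i - 1)) (x (2 * i)) (n (i - 1)) (n i)) =
       (\<Prod>i=1..r. h powi (?e i)\<^sup>2 * x (2 * i - 1) powi ?e i / qpoch_inf q q
          * theta (x (2 * i - 1)) (n (i - 1)) (n i))"
      by (intro prod.cong refl block_sum_eq_theta x)
    also have "\<dots> = h powi (\<Sum>i=1..r. (?e i)\<^sup>2) * (\<Prod>i=1..r. x (2 * i - 1) powi ?e i) / ?P
          * (\<Prod>i=1..r. theta (x (2 * i - 1)) (n (i - 1)) (n i))"
      by (simp add: prod.distrib prod_dividef prod_power_int)
    finally have blocks: "(\<Prod>i=1..r. block_sum (x (2 * i - 1)) (x (2 * i)) (n (i - 1)) (n i)) = \<dots>" .
    have tele: "x (2 * r + 1) ^ n r * (\<Prod>i=1..r. x (2 * i - 1) powi ?e i) =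
       (\<Prod>j=1..r. (x (2 * j + 1) / x (2 * j - 1)) ^ n j)"
    proof -
      have nz: "x (2 * i + 1) \<noteq> 0" if "i < r" for i
        using x[of "Suc i"] that by auto
      have idx: "2 * (i - 1) + 1 = 2 * i - 1" if "i \<in> {1..r}" for i :: nat
        using that by auto
      have "(\<Prod>i=1..r. x (2 * i - 1) powi ?e i) = (\<Prod>i=1..r. x (2 * (i - 1) + 1) powi ?e i)"
        "(\<Prod>j=1..r. (x (2 * j + 1) / x (2 * j - 1)) ^ n j) = (\<Prod>j=1..r. (x (2 * j + 1) / x (2 * (j - 1) + 1)) ^ n j)"
        by (intro prod.cong refl, simp only: idx)+
      then show ?thesis
        using telescoping_powers[of r "\<lambda>i. x (2 * i + 1)" n, OF nz] n0
        by (simp only: power_0 mult_1)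
    qed
    have "qpow h (1/4 * (\<Sum>i=1..r. (real (n i) - real (n (i - 1)))\<^sup>2)) = h powi (\<Sum>i=1..r. (?e i)\<^sup>2)"
      by (rule qpow_eqI) (simp, intro sum.cong refl power2_commute)
    then have "rhs n = h powi (\<Sum>i=1..r. (?e i)\<^sup>2) / (\<Prod>i=1..r. poch (n i))
        * (x (2 * r + 1) ^ n r * (\<Prod>i=1..r. x (2 * i - 1) powi ?e i))
        * (\<Prod>k=1..r. theta (x (2 * k - 1)) (n (k - 1)) (n k))"
      by (simp only: rhs_def tele)
    then show ?thesis
      unfolding blocks by simp
  qed
  have "((\<lambda>n. ?P * (x (2 * r + 1) ^ n r / (\<Prod>i=1..r. poch (n i)) *
        (\<Prod>i=1..r. block_sum (x (2 * i - 1)) (x (2 * i)) (n (i - 1)) (n i)))) has_sum ?P * ?S) (tuples r)"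
    by (intro has_sum_cmult_right decoupled_has_sum_block_sums)
  then have rhs: "(rhs has_sum ?P * ?S) (tuples r)"
    by (subst has_sum_cong[OF rhs_eq])
  show "nahm_term q h (2 * r + 1) x summable_on tuples (2 * r + 1)"
    using nahm_sum_odd_chain by (rule has_sum_imp_summable)
  show "rhs summable_on tuples r"
    using rhs by (rule has_sum_imp_summable)
  have "qpow h (1/2) = h\<^sup>2"
    using qpow_half_int[of 1] by simp
  then show "nahm_sum q h (2 * r + 1) x =
      qpoch_inf (- (qpow h (1/2) * x (2 * r + 1))) q / qpoch_inf q q ^ r * (\<Sum>\<^sub>\<infinity>n\<in>tuples r. rhs n)"
    unfolding nahm_sum_def infsumI[OF nahm_sum_odd_chain] infsumI[OF rhs] by simp
qed

end

lemma tuples_pred_eq_0: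
  assumes "k \<in> tuples r" and "j \<notin> {1..Suc r}"
  shows "k (j - 1) = 0"
  by (rule tuples_eq_0[OF assms(1)]) (use assms(2) in auto)

lemma prod_ivl_Suc_first:
  fixes F :: "nat \<Rightarrow> 'a :: comm_monoid_mult"
  shows "(\<Prod>j=1..Suc s. F j) = F 1 * (\<Prod>j=1..s. F (Suc j))"
  by (induction s) (simp_all add: mult_ac)

lemma bij_betw_tuples_prepend:
  "bij_betw (\<lambda>(N, k) j. if j = 1 then N else k (j - 1)) (UNIV \<times> tuples r) (tuples (Suc r))"
proof (rule bij_betw_byWitness[where f' = "\<lambda>n. (n 1, \<lambda>j. if j = 0 then 0 else n (Suc j))"])
  show "\<forall>z\<in>UNIV \<times> tuples r. (\<lambda>n. (n 1, \<lambda>j. if j = 0 then 0 else n (Suc j)))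
      ((\<lambda>(N, k) j. if j = 1 then N else k (j - 1)) z) = z"
    by (auto simp: tuples_def fun_eq_iff)
  show "\<forall>n\<in>tuples (Suc r). (\<lambda>(N, k) j. if j = 1 then N else k (j - 1))
      ((\<lambda>n. (n 1, \<lambda>j. if j = 0 then 0 else n (Suc j))) n) = n"
    by (auto simp: tuples_def fun_eq_iff)
  show "(\<lambda>(N, k) j. if j = 1 then N else k (j - 1)) ` (UNIV \<times> tuples r) \<subseteq> tuples (Suc r)"
    using tuples_pred_eq_0 by (auto simp: tuples_def[of "Suc r"] tuples_eq_0 simp del: One_nat_def)
  show "(\<lambda>n. (n 1, \<lambda>j. if j = 0 then 0 else n (Suc j))) ` tuples (Suc r) \<subseteq> UNIV \<times> tuples r"
    by (auto simp: tuples_def)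
qed

lemma bij_betw_tuples_prepend_0:
  "bij_betw (\<lambda>n j. n (j - 1)) (tuples s) {n \<in> tuples (Suc s). n 1 = 0}"
proof (rule bij_betw_byWitness[where f' = "\<lambda>n j. if j = 0 then 0 else n (Suc j)"])
  show "\<forall>n\<in>tuples s. (\<lambda>n j. if j = 0 then 0 else n (Suc j)) ((\<lambda>n j. n (j - 1)) n) = n"
    by (auto simp: tuples_def fun_eq_iff)
  show "\<forall>n\<in>{n \<in> tuples (Suc s). n 1 = 0}. (\<lambda>n j. n (j - 1)) ((\<lambda>n j. if j = 0 then 0 else n (Suc j)) n) = n"
  proof
    fix n assume n: "n \<in> {n \<in> tuples (Suc s). n 1 = 0}"
    then have "n 0 = 0" "n 1 = 0"
      by (auto intro: tuples_eq_0)
    then have "(if j - 1 = 0 then 0 else n (Suc (j - 1))) = n j" for j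
      by (cases "j \<le> 1") (auto simp: le_Suc_eq)
    then show "(\<lambda>n j. n (j - 1)) ((\<lambda>n j. if j = 0 then 0 else n (Suc j)) n) = n"
      by (simp only:)
  qed
  show "(\<lambda>n j. n (j - 1)) ` tuples s \<subseteq> {n \<in> tuples (Suc s). n 1 = 0}"
    using tuples_pred_eq_0 by (auto simp: tuples_def[of "Suc s"] tuples_eq_0 simp del: One_nat_def)
  show "(\<lambda>n j. if j = 0 then 0 else n (Suc j)) ` {n \<in> tuples (Suc s). n 1 = 0} \<subseteq> tuples s"
    by (auto simp: tuples_def)
qed

lemma tadpole_form_prepend_0:
  assumes "n 0 = 0" and "s \<ge> 1"
  shows "tadpole_form (Suc s) (\<lambda>j. n (j - 1)) = tadpole_form s n"
  using assms(2)
proof (induction s rule: dec_induct)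
  case base
  then show ?case
    using assms(1) by (simp add: tadpole_form_Suc tadpole_form_1)
next
  case (step s)
  then show ?case
    by (simp add: tadpole_form_Suc[of "Suc s"] tadpole_form_Suc[of s])
qed

context quarter_nome
begin

text \<open>
  With first parameter \<open>0\<close> only the terms with \<open>m\<^sub>1 = 0\<close> survive, and the first block becomes a simple sum over
  \<open>N = m\<^sub>2\<close>. The formula for even length sums over \<open>N\<close> and \<open>k\<close> jointly, and convergence of that
  double sum does not follow from the convergence of the iterated one. The decoupled
  family is therefore regrouped by the value of \<open>m\<^sub>2\<close> before anything is summed.
\<close>

lemma decoupled_has_sum_first_block_single:
  assumes y1: "y 1 = 0" and r: "r \<ge> 1"
  shows "((\<lambda>(N, k). y (2 * r + 1) ^ k r / (\<Prod>i=1..r. poch (k i)) *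
        (block 0 (y 2) 0 (k 1) 0 N * (\<Prod>i=2..r. block_sum (y (2 * i - 1)) (y (2 * i)) (k (i - 1)) (k i))))
     has_sum (\<Sum>\<^sub>\<infinity>(m, k)\<in>tuples (2 * r) \<times> tuples r. decoupled r y m k)) (UNIV \<times> tuples r)"
proof -
  let ?S = "\<Sum>\<^sub>\<infinity>(m, k)\<in>tuples (2 * r) \<times> tuples r. decoupled r y m k"
  let ?g = "\<lambda>((N, k), m). if m 2 = N then decoupled r y m k else 0"
  let ?G = "{((N, k), m). k \<in> tuples r \<and> m \<in> tuples (2 * r) \<and> N = m (2::nat)}"
  have bij: "bij_betw (\<lambda>(k, m). ((m 2, k), m)) (tuples r \<times> tuples (2 * r)) ?G"
    by (rule bij_betw_byWitness[where f' = "\<lambda>((N, k), m). (k, m)"]) auto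
  have "((\<lambda>z. ?g ((\<lambda>(k, m). ((m 2, k), m)) z)) has_sum ?S) (tuples r \<times> tuples (2 * r))"
    using decoupled_swap_has_sum[of r y] by (simp add: case_prod_unfold)
  then have "(?g has_sum ?S) ?G"
    unfolding has_sum_reindex_bij_betw[OF bij] .
  also have "?this \<longleftrightarrow> (?g has_sum ?S) ((UNIV \<times> tuples r) \<times> tuples (2 * r))"
    by (rule has_sum_cong_neutral) (auto split: if_splits)
  finally have total: "(?g has_sum ?S) ((UNIV \<times> tuples r) \<times> tuples (2 * r))" .
  show ?thesis
  proof (rule has_sum_SigmaD[OF total])
    fix z :: "nat \<times> (nat \<Rightarrow> nat)"
    assume "z \<in> UNIV \<times> tuples r"
    then obtain N k where z: "z = (N, k)" and k: "k \<in> tuples r"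
      by auto
    have k0: "k 0 = 0"
      using k by (rule tuples_eq_0) simp
    let ?b = "\<lambda>i. block (y (2 * i - 1)) (y (2 * i)) (k (i - 1)) (k i)"
    \<comment> \<open>The condition \<open>m\<^sub>1 = 0 \<and> m\<^sub>2 = N\<close> is absorbed into the first factor, so that the sum still factors.\<close>
    let ?f = "\<lambda>i M N'. if i = 1 then (if M = 0 \<and> N' = N then ?b 1 M N' else 0) else ?b i M N'"
    let ?s = "\<lambda>i. if i = 1 then ?b 1 0 N else block_sum (y (2 * i - 1)) (y (2 * i)) (k (i - 1)) (k i)"
    let ?c = "y (2 * r + 1) ^ k r / (\<Prod>i=1..r. poch (k i))"
    have "((\<lambda>(M, N'). ?f i M N') has_sum ?s i) UNIV" for i
    proof (cases "i = 1")
      case True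
      show ?thesis
        by (rule has_sum_finite_neutralI[where B = "{(0, N)}"]) (auto simp: True split: if_splits)
    next
      case False
      then show ?thesis
        using block_has_sum by simp
    qed
    then have "((\<lambda>m. ?c * (\<Prod>i=1..r. ?f i (m (2 * i - 1)) (m (2 * i)))) has_sum ?c * (\<Prod>i=1..r. ?s i)) (tuples (2 * r))"
      by (intro has_sum_cmult_right tuples_pair_prod_has_sum)
    moreover have "?c * (\<Prod>i=1..r. ?f i (m (2 * i - 1)) (m (2 * i))) = ?g (z, m)" for m
    proof -
      have first: "(\<Prod>i=1..r. F i) = F 1 * (\<Prod>i=2..r. F i)" for F :: "nat \<Rightarrow> complex"
        using prod.atLeast_Suc_atMost[OF r, of F] by (simp add: numeral_2_eq_2)
      have rest: "(\<Prod>i=2..r. ?f i (m (2 * i - 1)) (m (2 * i))) = (\<Prod>i=2..r. ?b i (m (2 * i - 1)) (m (2 * i)))"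
        by (intro prod.cong refl) auto
      let ?R = "\<Prod>i=2..r. ?b i (m (2 * i - 1)) (m (2 * i))"
      have f: "(\<Prod>i=1..r. ?f i (m (2 * i - 1)) (m (2 * i))) =
          (if m 1 = 0 \<and> m 2 = N then ?b 1 (m 1) (m 2) else 0) * ?R"
        unfolding first rest by simp
      have decoupled: "decoupled r y m k = ?c * (?b 1 (m 1) (m 2) * ?R)"
        unfolding decoupled_def first[of "\<lambda>i. ?b i (m (2 * i - 1)) (m (2 * i))"] by simp
      have zero: "?b 1 (m 1) (m 2) = 0" if "m 1 \<noteq> 0"
        using that y1 by (simp add: block_def)
      show ?thesis
        unfolding f z case_prod_conv decoupled using zero by (cases "m 1 = 0"; cases "m 2 = N") simp_all
    qed
    moreover have "(\<Prod>i=1..r. ?s i) =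
        block 0 (y 2) 0 (k 1) 0 N * (\<Prod>i=2..r. block_sum (y (2 * i - 1)) (y (2 * i)) (k (i - 1)) (k i))"
    proof -
      have "(\<Prod>i=1..r. ?s i) = ?s 1 * (\<Prod>i=2..r. ?s i)"
        using prod.atLeast_Suc_atMost[OF r, of ?s] by (simp add: numeral_2_eq_2)
      also have "(\<Prod>i=2..r. ?s i) = (\<Prod>i=2..r. block_sum (y (2 * i - 1)) (y (2 * i)) (k (i - 1)) (k i))"
        by (intro prod.cong refl) auto
      finally show ?thesis
        using y1 k0 by simp
    qed
    ultimately show "((\<lambda>m. ?g (z, m)) has_sum (case z of (N, k) \<Rightarrow> y (2 * r + 1) ^ k r / (\<Prod>i=1..r. poch (k i)) *
        (block 0 (y 2) 0 (k 1) 0 N * (\<Prod>i=2..r. block_sum (y (2 * i - 1)) (y (2 * i)) (k (i - 1)) (k i))))) (tuples (2 * r))"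
      by (simp add: z)
  qed
qed

text \<open>
  Prepending a zero to the tuple lengthens the chain by one: \<open>0\<^sup>2 + (0 - n\<^sub>1)\<^sup>2 = n\<^sub>1\<^sup>2\<close>, and the new first
  parameter enters with exponent \<open>0\<close>.
\<close>

lemma nahm_term_prepend_0:
  fixes x y :: "nat \<Rightarrow> complex"
  assumes "n \<in> tuples s" and "s \<ge> 1" and "\<And>j. j \<ge> 1 \<Longrightarrow> y (Suc j) = x j"
  shows "nahm_term q h (Suc s) y (\<lambda>j. n (j - 1)) = nahm_term q h s x n"
proof -
  have n0: "n 0 = 0"
    using assms(1) by (rule tuples_eq_0) simp
  have "(\<Prod>j=1..s. y (Suc j) ^ n j) = (\<Prod>j=1..s. x j ^ n j)"
    using assms(3) by (intro prod.cong refl) auto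
  then show ?thesis
    unfolding nahm_term_def prod_ivl_Suc_first tadpole_form_prepend_0[of n s, OF n0 assms(2)] using n0 by simp
qed

text \<open>
  The chain of length \<open>2r + 1\<close> is used with parameters \<open>y = (0, x\<^sub>1, \<dots>, x\<^sub>2\<^sub>r)\<close>. Its pairs are
  \<open>(0, x\<^sub>1), (x\<^sub>2, x\<^sub>3), \<dots>\<close>, so the hypothesis applies to all but the first. The index tuple of the formula is
  \<open>(N, k\<^sub>1, \<dots>, k\<^sub>r)\<close>, one longer than \<open>k\<close>.
\<close>

theorem nahm_sum_even:
  fixes x :: "nat \<Rightarrow> complex"
  assumes r: "r \<ge> 1" and x: "\<And>i. i \<in> {0..r - 1} \<Longrightarrow> x (2 * i) * x (2 * i + 1) = 1"
  defines "rhs \<equiv> \<lambda>n. qpow h (1/2 * (real (n 1))\<^sup>2 + 1/2 * (real (n 1) + real (n 2))\<^sup>2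
                      + 1/4 * (\<Sum>i=2..r. (real (n i) - real (n (i + 1)))\<^sup>2))
              / (\<Prod>i=1..r + 1. poch (n i))
              * x 0 powi (- int (n 1))
              * (\<Prod>j=1..r. (x (2 * j) / x (2 * j - 2)) ^ n (j + 1))
              * (\<Prod>k=2..r. theta (x (2 * k - 2)) (n k) (n (k + 1)))"
  shows "nahm_term q h (2 * r) x summable_on tuples (2 * r)"
    and "rhs summable_on tuples (r + 1)"
    and "nahm_sum q h (2 * r) x =
      qpoch_inf (- (qpow h (1/2) * x (2 * r))) q / qpoch_inf q q ^ (r - 1) * (\<Sum>\<^sub>\<infinity>n\<in>tuples (r + 1). rhs n)"
proof -
  define y where "y = (\<lambda>j. if j \<le> 1 then 0 else x (j - 1))"
  have y1: "y 1 = 0" and y2: "y 2 = x 1"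
    by (simp_all add: y_def)
  have y_Suc: "y (Suc j) = x j" if "j \<ge> 1" for j
    using that by (simp add: y_def)
  have y_top: "y (2 * r + 1) = x (2 * r)"
    using r by (simp add: y_def)
  let ?S = "\<Sum>\<^sub>\<infinity>(m, k)\<in>tuples (2 * r) \<times> tuples r. decoupled r y m k"
  let ?P = "qpoch_inf q q ^ (r - 1)"
  let ?Euler = "qpoch_inf (- (h\<^sup>2 * x (2 * r))) q"
  have nahm: "(nahm_term q h (2 * r) x has_sum ?Euler * ?S) (tuples (2 * r))"
  proof -
    have "(nahm_term q h (2 * r + 1) y has_sum ?Euler * ?S) (tuples (2 * r + 1))"
      using nahm_sum_odd_chain[of r y] unfolding y_top .
    \<comment> \<open>A term with \<open>n\<^sub>1 > 0\<close> contains the factor \<open>y\<^sub>1 = 0\<close>.\<close>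
    also have "?this \<longleftrightarrow> (nahm_term q h (2 * r + 1) y has_sum ?Euler * ?S) {n \<in> tuples (Suc (2 * r)). n 1 = 0}"
    proof (rule has_sum_cong_neutral)
      fix n assume "n \<in> tuples (2 * r + 1) - {n \<in> tuples (Suc (2 * r)). n 1 = 0}"
      then have "y 1 ^ n 1 = 0"
        using y1 by simp
      then have "(\<Prod>j=1..2 * r + 1. y j ^ n j) = 0"
        by (intro prod_zero) (auto intro!: bexI[of _ 1])
      then show "nahm_term q h (2 * r + 1) y n = 0"
        by (simp only: nahm_term_def mult_zero_right div_0)
    qed auto
    also have "\<dots> \<longleftrightarrow> ((\<lambda>n. nahm_term q h (2 * r + 1) y (\<lambda>j. n (j - 1))) has_sum ?Euler * ?S) (tuples (2 * r))"
      by (rule has_sum_reindex_bij_betw[OF bij_betw_tuples_prepend_0, symmetric])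
    also have "\<dots> \<longleftrightarrow> (nahm_term q h (2 * r) x has_sum ?Euler * ?S) (tuples (2 * r))"
    proof (rule has_sum_cong)
      fix n assume n: "n \<in> tuples (2 * r)"
      show "nahm_term q h (2 * r + 1) y (\<lambda>j. n (j - 1)) = nahm_term q h (2 * r) x n"
        using nahm_term_prepend_0[where x = x and y = y, OF n _ y_Suc] r by simp
    qed
    finally show ?thesis .
  qed
  let ?F = "\<lambda>(N, k). y (2 * r + 1) ^ k r / (\<Prod>i=1..r. poch (k i)) *
        (block 0 (y 2) 0 (k 1) 0 N * (\<Prod>i=2..r. block_sum (y (2 * i - 1)) (y (2 * i)) (k (i - 1)) (k i)))"
  let ?pre = "\<lambda>(N, k) j. if j = 1 then N else k (j - 1)"
  have rhs_eq: "rhs (?pre (N, k)) = ?P * ?F (N, k)" if k: "k \<in> tuples r" for N k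
  proof -
    let ?n = "?pre (N, k)"
    let ?e = "\<lambda>i. int (k (i - 1)) - int (k i)"
    have k0: "k 0 = 0"
      using k by (rule tuples_eq_0) simp
    have n: "?n 1 = N" "?n 2 = k 1"
      by simp_all
    have n_ge_2: "?n i = k (i - 1)" "?n (i + 1) = k i" if "i \<in> {2..r}" for i
      using that by auto
    have x01: "x 0 * x 1 = 1"
      using x[of 0] by simp
    then have x0: "x 0 \<noteq> 0" and x1: "x 1 = inverse (x 0)"
      by (auto simp: inverse_unique)
    have first: "(\<Prod>i=1..r. G i) = G 1 * (\<Prod>i=2..r. G i)" for G :: "nat \<Rightarrow> complex"
      using prod.atLeast_Suc_atMost[OF r, of G] by (simp add: numeral_2_eq_2)
    have exponent: "qpow h (1/2 * (real (?n 1))\<^sup>2 + 1/2 * (real (?n 1) + real (?n 2))\<^sup>2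
          + 1/4 * (\<Sum>i=2..r. (real (?n i) - real (?n (i + 1)))\<^sup>2))
       = h powi (2 * (int N)\<^sup>2 + 2 * (int N + int (k 1))\<^sup>2) * h powi (\<Sum>i=2..r. (?e i)\<^sup>2)"
    proof -
      have "(\<Sum>i=2..r. (real (?n i) - real (?n (i + 1)))\<^sup>2) = of_int (\<Sum>i=2..r. (?e i)\<^sup>2)"
        unfolding of_int_sum by (intro sum.cong refl) (simp only: n_ge_2, simp)
      then have "qpow h (1/2 * (real (?n 1))\<^sup>2 + 1/2 * (real (?n 1) + real (?n 2))\<^sup>2
          + 1/4 * (\<Sum>i=2..r. (real (?n i) - real (?n (i + 1)))\<^sup>2)) =
        h powi ((2 * (int N)\<^sup>2 + 2 * (int N + int (k 1))\<^sup>2) + (\<Sum>i=2..r. (?e i)\<^sup>2))"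
        unfolding n by (intro qpow_eqI) simp
      then show ?thesis
        by (simp only: power_int_add h_nonzero simp_thms)
    qed
    have poch: "(\<Prod>i=1..r + 1. poch (?n i)) = poch N * (\<Prod>i=1..r. poch (k i))"
      unfolding Suc_eq_plus1[symmetric] prod_ivl_Suc_first by simp
    have block: "block 0 (y 2) 0 (k 1) 0 N =
       h powi (2 * (int N)\<^sup>2 + 2 * (int N + int (k 1))\<^sup>2) * x 0 powi (- int N) * x 0 powi ?e 1 / poch N"
    proof -
      have "block_exponent 0 (k 1) 0 N = 2 * (int N)\<^sup>2 + 2 * (int N + int (k 1))\<^sup>2"
        by (simp add: block_exponent_def power2_eq_square algebra_simps)
      moreover have "x 1 ^ (N + k 1) = x 0 powi (- int N) * x 0 powi ?e 1"
        unfolding x1 using x0 k0 by (simp add: power_add power_int_minus power_inverse)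
      ultimately show ?thesis
        by (simp add: block_def y2)
    qed
    have "(\<Prod>i=2..r. block_sum (y (2 * i - 1)) (y (2 * i)) (k (i - 1)) (k i)) =
       (\<Prod>i=2..r. h powi (?e i)\<^sup>2 * x (2 * (i - 1)) powi ?e i / qpoch_inf q q * theta (x (2 * i - 2)) (?n i) (?n (i + 1)))"
    proof (intro prod.cong refl)
      fix i assume i: "i \<in> {2..r}"
      then have "y (2 * i - 1) = x (2 * i - 2)" "y (2 * i) = x (2 * (i - 1) + 1)" "2 * i - 2 = 2 * (i - 1)"
        by (auto simp: y_def numeral_2_eq_2 intro!: arg_cong[of _ _ x])
      moreover have "x (2 * (i - 1)) * x (2 * (i - 1) + 1) = 1"
        using i by (intro x) auto
      ultimately show "block_sum (y (2 * i - 1)) (y (2 * i)) (k (i - 1)) (k i) =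
          h powi (?e i)\<^sup>2 * x (2 * (i - 1)) powi ?e i / qpoch_inf q q * theta (x (2 * i - 2)) (?n i) (?n (i + 1))"
        using block_sum_eq_theta by (simp only: n_ge_2[OF i])
    qed
    also have "\<dots> = h powi (\<Sum>i=2..r. (?e i)\<^sup>2) * (\<Prod>i=2..r. x (2 * (i - 1)) powi ?e i) / ?P
          * (\<Prod>i=2..r. theta (x (2 * i - 2)) (?n i) (?n (i + 1)))"
      using r by (simp add: prod.distrib prod_dividef prod_power_int del: prod_cases)
    finally have blocks: "(\<Prod>i=2..r. block_sum (y (2 * i - 1)) (y (2 * i)) (k (i - 1)) (k i)) = \<dots>" .
    have tele: "x (2 * r) ^ k r * (x 0 powi ?e 1 * (\<Prod>i=2..r. x (2 * (i - 1)) powi ?e i)) =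
       (\<Prod>j=1..r. (x (2 * j) / x (2 * j - 2)) ^ ?n (j + 1))"
    proof -
      have nz: "x (2 * i) \<noteq> 0" if "i < r" for i
      proof -
        have "i \<in> {0..r - 1}"
          using that by auto
        then show ?thesis
          using x by fastforce
      qed
      \<comment> \<open>The power \<open>x\<^sub>1\<^bsup>k\<^sub>1\<^esup>\<close> of the first block is the missing term \<open>i = 1\<close> of the telescoping product, as \<open>x\<^sub>1 = 1 / x\<^sub>0\<close> and \<open>k\<^sub>0 = 0\<close>.\<close>
      have "x 0 powi ?e 1 * (\<Prod>i=2..r. x (2 * (i - 1)) powi ?e i) = (\<Prod>i=1..r. x (2 * (i - 1)) powi ?e i)"
        unfolding first by simp
      moreover have "(\<Prod>j=1..r. (x (2 * j) / x (2 * j - 2)) ^ ?n (j + 1)) = (\<Prod>j=1..r. (x (2 * j) / x (2 * (j - 1))) ^ k j)"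
        by (intro prod.cong refl) (auto simp: diff_mult_distrib2)
      ultimately show ?thesis
        using telescoping_powers[of r "\<lambda>i. x (2 * i)" k, OF nz] k0 by simp
    qed
    have "rhs ?n = h powi (2 * (int N)\<^sup>2 + 2 * (int N + int (k 1))\<^sup>2) * h powi (\<Sum>i=2..r. (?e i)\<^sup>2)
        / (poch N * (\<Prod>i=1..r. poch (k i))) * x 0 powi (- int N)
        * (x (2 * r) ^ k r * (x 0 powi ?e 1 * (\<Prod>i=2..r. x (2 * (i - 1)) powi ?e i)))
        * (\<Prod>i=2..r. theta (x (2 * i - 2)) (?n i) (?n (i + 1)))"
      unfolding rhs_def exponent poch tele unfolding n ..
    moreover have "?F (N, k) = x (2 * r) ^ k r / (\<Prod>i=1..r. poch (k i)) *
       (h powi (2 * (int N)\<^sup>2 + 2 * (int N + int (k 1))\<^sup>2) * x 0 powi (- int N) * x 0 powi ?e 1 / poch N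
        * (h powi (\<Sum>i=2..r. (?e i)\<^sup>2) * (\<Prod>i=2..r. x (2 * (i - 1)) powi ?e i) / ?P
          * (\<Prod>i=2..r. theta (x (2 * i - 2)) (?n i) (?n (i + 1)))))"
      by (simp only: case_prod_conv block blocks y_top)
    ultimately show ?thesis
      by (simp add: mult_ac)
  qed
  have "((\<lambda>z. ?P * ?F z) has_sum ?P * ?S) (UNIV \<times> tuples r)"
    using decoupled_has_sum_first_block_single[of y r, OF y1 r] by (rule has_sum_cmult_right)
  also have "?this \<longleftrightarrow> ((\<lambda>z. rhs (?pre z)) has_sum ?P * ?S) (UNIV \<times> tuples r)"
    by (rule has_sum_cong) (use rhs_eq in auto)
  also have "\<dots> \<longleftrightarrow> (rhs has_sum ?P * ?S) (tuples (Suc r))"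
    by (rule has_sum_reindex_bij_betw[OF bij_betw_tuples_prepend])
  finally have rhs: "(rhs has_sum ?P * ?S) (tuples (r + 1))"
    by simp
  show "nahm_term q h (2 * r) x summable_on tuples (2 * r)"
    using nahm by (rule has_sum_imp_summable)
  show "rhs summable_on tuples (r + 1)"
    using rhs by (rule has_sum_imp_summable)
  have "qpow h (1/2) = h\<^sup>2"
    using qpow_half_int[of 1] by simp
  then show "nahm_sum q h (2 * r) x =
      qpoch_inf (- (qpow h (1/2) * x (2 * r))) q / qpoch_inf q q ^ (r - 1) * (\<Sum>\<^sub>\<infinity>n\<in>tuples (r + 1). rhs n)"
    unfolding nahm_sum_def infsumI[OF nahm] infsumI[OF rhs] by simp
qed

end

theorem theorem1p2:
  fixes q h :: complex and r :: nat
  assumes "0 < norm q" and "norm q < 1" and "h ^ 4 = q" and "r \<ge> 1"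
  shows
    "(\<forall>x :: nat \<Rightarrow> complex. (\<forall>i\<in>{0..r-1}. x (2*i) * x (2*i+1) = 1) \<longrightarrow>
       (let theta_term = (\<lambda>n k (l::int).
              qpow h ((of_int l - (real (n k) - real (n (k+1))) / 2)\<^sup>2) * x (2*k-2) powi (-l));
            rhs_term = (\<lambda>n.
              qpow h (1/2 * (real (n 1))\<^sup>2 + 1/2 * (real (n 1) + real (n 2))\<^sup>2
                      + 1/4 * (\<Sum>i=2..r. (real (n i) - real (n (i+1)))\<^sup>2))
              / (\<Prod>i=1..r+1. qpoch q q (n i))
              * x 0 powi (- int (n 1))
              * (\<Prod>j=1..r. (x (2*j) / x (2*j-2)) ^ n (j+1))
              * (\<Prod>k=2..r. \<Sum>\<^sub>\<infinity>l\<in>UNIV. theta_term n k l))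
        in nahm_term q h (2*r) x summable_on tuples (2*r) \<and>
           (\<forall>n\<in>tuples (r+1). \<forall>k\<in>{2..r}. theta_term n k summable_on UNIV) \<and>
           rhs_term summable_on tuples (r+1) \<and>
           nahm_sum q h (2*r) x =
             qpoch_inf (- (qpow h (1/2) * x (2*r))) q / qpoch_inf q q ^ (r-1)
             * (\<Sum>\<^sub>\<infinity>n\<in>tuples (r+1). rhs_term n)))
     \<and>
     (\<forall>x :: nat \<Rightarrow> complex. (\<forall>i\<in>{1..r}. x (2*i-1) * x (2*i) = 1) \<longrightarrow>
       (let theta_term = (\<lambda>n k (l::int).
              qpow h ((of_int l - (real (n (k-1)) - real (n k)) / 2)\<^sup>2) * x (2*k-1) powi (-l));
            rhs_term = (\<lambda>n.
              qpow h (1/4 * (\<Sum>i=1..r. (real (n i) - real (n (i-1)))\<^sup>2))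
              / (\<Prod>i=1..r. qpoch q q (n i))
              * (\<Prod>j=1..r. (x (2*j+1) / x (2*j-1)) ^ n j)
              * (\<Prod>k=1..r. \<Sum>\<^sub>\<infinity>l\<in>UNIV. theta_term n k l))
        in nahm_term q h (2*r+1) x summable_on tuples (2*r+1) \<and>
           (\<forall>n\<in>tuples r. \<forall>k\<in>{1..r}. theta_term n k summable_on UNIV) \<and>
           rhs_term summable_on tuples r \<and>
           nahm_sum q h (2*r+1) x =
             qpoch_inf (- (qpow h (1/2) * x (2*r+1))) q / qpoch_inf q q ^ r
             * (\<Sum>\<^sub>\<infinity>n\<in>tuples r. rhs_term n)))"
proof -
  interpret quarter_nome q h
    by unfold_locales (fact assms)+
  show ?thesis
    unfolding Let_def
  proof (intro conjI allI impI ballI)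
    fix x :: "nat \<Rightarrow> complex"
    assume x: "\<forall>i\<in>{0..r-1}. x (2*i) * x (2*i+1) = 1"
    note even = nahm_sum_even[where x = x, OF assms(4) bspec[OF x], unfolded theta_def]
    show "nahm_term q h (2*r) x summable_on tuples (2*r)"
      by (rule even(1))
    show "(\<lambda>n. qpow h (1/2 * (real (n 1))\<^sup>2 + 1/2 * (real (n 1) + real (n 2))\<^sup>2
                      + 1/4 * (\<Sum>i=2..r. (real (n i) - real (n (i+1)))\<^sup>2))
              / (\<Prod>i=1..r+1. qpoch q q (n i))
              * x 0 powi (- int (n 1))
              * (\<Prod>j=1..r. (x (2*j) / x (2*j-2)) ^ n (j+1))
              * (\<Prod>k=2..r. \<Sum>\<^sub>\<infinity>l\<in>UNIV. qpow h ((of_int l - (real (n k) - real (n (k+1))) / 2)\<^sup>2) * x (2*k-2) powi (-l)))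
        summable_on tuples (r+1)"
      by (rule even(2))
    show "nahm_sum q h (2*r) x =
             qpoch_inf (- (qpow h (1/2) * x (2*r))) q / qpoch_inf q q ^ (r-1)
             * (\<Sum>\<^sub>\<infinity>n\<in>tuples (r+1). qpow h (1/2 * (real (n 1))\<^sup>2 + 1/2 * (real (n 1) + real (n 2))\<^sup>2
                      + 1/4 * (\<Sum>i=2..r. (real (n i) - real (n (i+1)))\<^sup>2))
              / (\<Prod>i=1..r+1. qpoch q q (n i))
              * x 0 powi (- int (n 1))
              * (\<Prod>j=1..r. (x (2*j) / x (2*j-2)) ^ n (j+1))
              * (\<Prod>k=2..r. \<Sum>\<^sub>\<infinity>l\<in>UNIV. qpow h ((of_int l - (real (n k) - real (n (k+1))) / 2)\<^sup>2) * x (2*k-2) powi (-l)))"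
      by (rule even(3))
    fix n k assume "k \<in> {2..r}"
    then have "k - 1 \<in> {0..r-1}" and k: "2 * k - 2 = 2 * (k - 1)"
      by auto
    then have "x (2 * (k - 1)) * x (2 * (k - 1) + 1) = 1"
      using x by blast
    then show "(\<lambda>l. qpow h ((of_int l - (real (n k) - real (n (k+1))) / 2)\<^sup>2) * x (2*k-2) powi (-l))
        summable_on UNIV"
      unfolding k by (rule theta_summable)
  next
    fix x :: "nat \<Rightarrow> complex"
    assume x: "\<forall>i\<in>{1..r}. x (2*i-1) * x (2*i) = 1"
    note odd = nahm_sum_odd[where x = x, OF bspec[OF x], unfolded theta_def]
    show "nahm_term q h (2*r+1) x summable_on tuples (2*r+1)"
      by (rule odd(1))
    show "(\<lambda>n. qpow h (1/4 * (\<Sum>i=1..r. (real (n i) - real (n (i-1)))\<^sup>2))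
              / (\<Prod>i=1..r. qpoch q q (n i))
              * (\<Prod>j=1..r. (x (2*j+1) / x (2*j-1)) ^ n j)
              * (\<Prod>k=1..r. \<Sum>\<^sub>\<infinity>l\<in>UNIV. qpow h ((of_int l - (real (n (k-1)) - real (n k)) / 2)\<^sup>2) * x (2*k-1) powi (-l)))
        summable_on tuples r"
      by (rule odd(2))
    show "nahm_sum q h (2*r+1) x =
             qpoch_inf (- (qpow h (1/2) * x (2*r+1))) q / qpoch_inf q q ^ r
             * (\<Sum>\<^sub>\<infinity>n\<in>tuples r. qpow h (1/4 * (\<Sum>i=1..r. (real (n i) - real (n (i-1)))\<^sup>2))
              / (\<Prod>i=1..r. qpoch q q (n i))
              * (\<Prod>j=1..r. (x (2*j+1) / x (2*j-1)) ^ n j)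
              * (\<Prod>k=1..r. \<Sum>\<^sub>\<infinity>l\<in>UNIV. qpow h ((of_int l - (real (n (k-1)) - real (n k)) / 2)\<^sup>2) * x (2*k-1) powi (-l)))"
      by (rule odd(3))
    fix n k assume "k \<in> {1..r}"
    then show "(\<lambda>l. qpow h ((of_int l - (real (n (k-1)) - real (n k)) / 2)\<^sup>2) * x (2*k-1) powi (-l))
        summable_on UNIV"
      using x theta_summable by blast
  qed
qed

end
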